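(* Let $\Gamma$ be a countable group such that there exists a finitely generated normal subgroup $N \leq \Gamma$ with $\Gamma/N \cong \mathbb{Z}^2$. Then $\Gamma$ does not have finite approximability on tournaments. In particular, with the exception of $\mathbb{Z}$, no finitely generated nilpotent torsion-free group has finite approximability on tournaments.
   Context: Groups are countable and discrete. A tournament is a directed graph $(X,R)$ (without loops) such that for any distinct $x,y\in X$ exactly one of the arrows $(x,y)$, $(y,x)$ is in $R$; $X$ may be infinite. An action $\alpha$ of a group $\Gamma$ by automorphisms on a tournament $X$ is finitely approximable if for every finite $F\subseteq\Gamma$ with $1\in F$ and every finite $X_0\subseteq X$ there exist a finite tournament $Y$, an action $\beta$ of $\Gamma$ on $Y$ by automorphisms, and an injection $e:\alpha[F\times X_0]\to Y$ which is an embedding of the substructure of $X$ induced on $\alpha[F\times X_0]=\{\alpha(f,x): f\in F, x\in X_0\}$ into $Y$ and satisfies $\beta(f,e(x))=e(\alpha(f,x))$ for all $f\in F$, $x\in X_0$. A group $\Gamma$ has finite approximability on tournaments if every action of $\Gamma$ by automorphisms on a tournament is finitely approximable.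
   Formalization: In the "in particular" clause the group is also assumed to be nontrivial, since the trivial group is finitely generated, nilpotent and torsion-free, is not Z, and does have finite approximability on tournaments. *)

theory Defs
  imports "HOL-Algebra.Algebra" "HOL-Library.Countable_Set" "HOL-Library.Infinite_Typeclass"
begin

definition tournament :: "'x set \<Rightarrow> 'x rel \<Rightarrow> bool" where
  "tournament V R \<longleftrightarrow>
     R \<subseteq> V \<times> V \<and> (\<forall>x\<in>V. (x, x) \<notin> R) \<and>
     (\<forall>x\<in>V. \<forall>y\<in>V. x \<noteq> y \<longrightarrow> ((x, y) \<in> R) \<noteq> ((y, x) \<in> R))"

definition tournament_action ::
    "('g, 'm) monoid_scheme \<Rightarrow> 'x set \<Rightarrow> 'x rel \<Rightarrow> ('g \<Rightarrow> 'x \<Rightarrow> 'x) \<Rightarrow> bool" where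
  "tournament_action G V R \<alpha> \<longleftrightarrow>
     tournament V R \<and> group_action G V \<alpha> \<and>
     (\<forall>g\<in>carrier G. \<forall>x\<in>V. \<forall>y\<in>V. (x, y) \<in> R \<longleftrightarrow> (\<alpha> g x, \<alpha> g y) \<in> R)"

(* Every finite tournament is isomorphic to one with vertices in nat, so it is no
   restriction to look for Y among sets of natural numbers. *)
definition finitely_approximable ::
    "('g, 'm) monoid_scheme \<Rightarrow> 'x set \<Rightarrow> 'x rel \<Rightarrow> ('g \<Rightarrow> 'x \<Rightarrow> 'x) \<Rightarrow> bool" where
  "finitely_approximable G V R \<alpha> \<longleftrightarrow>
     (\<forall>F V0. finite F \<and> F \<subseteq> carrier G \<and> \<one>\<^bsub>G\<^esub> \<in> F \<and> finite V0 \<and> V0 \<subseteq> V \<longrightarrow>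
       (let A = {\<alpha> f x | f x. f \<in> F \<and> x \<in> V0} in
        \<exists>(Y :: nat set) S \<beta> e.
          finite Y \<and> tournament_action G Y S \<beta> \<and>
          e \<in> A \<rightarrow> Y \<and> inj_on e A \<and>
          (\<forall>a\<in>A. \<forall>b\<in>A. (a, b) \<in> R \<longleftrightarrow> (e a, e b) \<in> S) \<and>
          (\<forall>f\<in>F. \<forall>x\<in>V0. \<beta> f (e x) = e (\<alpha> f x))))"

(* HOL cannot quantify over all types inside a formula, so the type 'x containing the
   vertices of the tournaments is an explicit parameter.  For countable G the choice of
   an infinite type 'x is immaterial: a failure of finite approximability for F and V0
   already occurs on the (countable) invariant subtournament generated by V0. *)
definition finite_approximability_on_tournaments ::
    "'x itself \<Rightarrow> ('g, 'm) monoid_scheme \<Rightarrow> bool" where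
  "finite_approximability_on_tournaments _ G \<longleftrightarrow>
     (\<forall>(V :: 'x set) R \<alpha>. tournament_action G V R \<alpha> \<longrightarrow> finitely_approximable G V R \<alpha>)"

definition fin_gen_subgroup :: "('g, 'm) monoid_scheme \<Rightarrow> 'g set \<Rightarrow> bool" where
  "fin_gen_subgroup G H \<longleftrightarrow> (\<exists>S. finite S \<and> S \<subseteq> carrier G \<and> H = generate G S)"

(* The lower central series, starting with the whole group at index 0. *)
primrec lower_central :: "('g, 'm) monoid_scheme \<Rightarrow> nat \<Rightarrow> 'g set" where
  "lower_central G 0 = carrier G"
| "lower_central G (Suc n) =
     generate G {g \<otimes>\<^bsub>G\<^esub> h \<otimes>\<^bsub>G\<^esub> inv\<^bsub>G\<^esub> g \<otimes>\<^bsub>G\<^esub> inv\<^bsub>G\<^esub> h | g h.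
       g \<in> lower_central G n \<and> h \<in> carrier G}"

definition nilpotent :: "('g, 'm) monoid_scheme \<Rightarrow> bool" where
  "nilpotent G \<longleftrightarrow> (\<exists>n. lower_central G n = {\<one>\<^bsub>G\<^esub>})"

definition torsion_free :: "('g, 'm) monoid_scheme \<Rightarrow> bool" where
  "torsion_free G \<longleftrightarrow>
     (\<forall>g\<in>carrier G. g \<noteq> \<one>\<^bsub>G\<^esub> \<longrightarrow> (\<forall>n::nat. n > 0 \<longrightarrow> g [^]\<^bsub>G\<^esub> n \<noteq> \<one>\<^bsub>G\<^esub>))"

end

theory Submission
  imports Defs
begin

text \<open>
The proof rests on the fact that a finite group of automorphisms of a tournament has odd order: an
automorphism of order two would swap two vertices and so reverse an arrow. In every action on a finite
tournament, an element $g$ therefore acts like one of its own even powers $g^{2k}$.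

Suppose that two points $x$ and $y$ are fixed by $A$ and $B$, and that all even powers of $g$ lie in the product
\<open>\<langle>A\<rangle>\<langle>B\<rangle>\<close>. In a finite approximation $g$ then acts like such a product, and this forces the
arrow between $x$ and $g y$ to point like the arrow between $x$ and $y$
(\<open>not_finitely_approximableI\<close>). So it suffices to have an infinite tournament in which these two arrows
are opposite. On the disjoint union of the coset spaces $G/H$ and $G/K$, where $A \subseteq H$ and
$B \subseteq K$, such a tournament exists as soon as $g \notin HK$ and $H$ and $K$ are closed under square
roots, so that no element swaps two points (\<open>not_finite_approximabilityI\<close>). The model case is
\<open>\<int>\<^sup>2\<close> with \<open>(1, 0)\<close> in the role of $g$ and the diagonal and the antidiagonal as $H$ and $K$: their
sum consists of the pairs with an even coordinate sum, so it contains the even multiples of \<open>(1, 0)\<close>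
only.

A group with a quotient \<open>\<int>\<^sup>2\<close> by a finitely generated kernel inherits this configuration by taking
preimages.

For a finitely generated torsion-free nilpotent group, the configuration is found in a subgroup
\<open>\<int>\<^sup>2\<close> instead of a quotient. Let $u$ be an element that is not a square and let $w$ be an element that
commutes with $u$ and is independent of it. Put $g = uw$ and $v = uw^2$, so that $g^2 = uv$, and take for
$H$ and $K$ the isolators of $u$ and $v$, that is, the sets of all roots of their powers. These are
subgroups, and $g \in HK$ would make $u$ a square, because in torsion-free nilpotent groups roots are
unique and an element commutes with everything that one of its nontrivial powers commutes with
(\<open>commutes_if_pow_commutes\<close>). An element $u$ exists because a finitely generated nilpotent group
consisting of squares is torsion (\<open>ex_nonsquare\<close>). A partner $w$ exists for every $u$ unless the group is
infinite cyclic (\<open>ex_commuting_nonsquare\<close>).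
\<close>

section \<open>Group actions and odd orders\<close>

lemma group_actionI:
  fixes G (structure)
  assumes "group G"
    and closed: "\<And>g x. g \<in> carrier G \<Longrightarrow> x \<in> V \<Longrightarrow> \<alpha> g x \<in> V"
    and ext: "\<And>g. g \<in> carrier G \<Longrightarrow> \<alpha> g \<in> extensional V"
    and one: "\<And>x. x \<in> V \<Longrightarrow> \<alpha> \<one>\<^bsub>G\<^esub> x = x"
    and mult: "\<And>g h x. g \<in> carrier G \<Longrightarrow> h \<in> carrier G \<Longrightarrow> x \<in> V \<Longrightarrow> \<alpha> (g \<otimes>\<^bsub>G\<^esub> h) x = \<alpha> g (\<alpha> h x)"
  shows "group_action G V \<alpha>"
proof -
  interpret group G by fact
  have bij: "\<alpha> g \<in> Bij V" if g: "g \<in> carrier G" for g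
  proof -
    have "\<alpha> (inv g) (\<alpha> g x) = x" "\<alpha> g (\<alpha> (inv g) x) = x" if "x \<in> V" for x
      using that g mult[of "inv g" g x] mult[of g "inv g" x] one by auto
    then have "bij_betw (\<alpha> g) V V"
      using closed g by (intro bij_betw_byWitness[where f' = "\<alpha> (inv g)"]) auto
    then show ?thesis
      using ext g by (simp add: Bij_def)
  qed
  have "\<alpha> (g \<otimes> h) = compose V (\<alpha> g) (\<alpha> h)" if "g \<in> carrier G" "h \<in> carrier G" for g h
  proof
    fix x
    show "\<alpha> (g \<otimes> h) x = compose V (\<alpha> g) (\<alpha> h) x"
    proof (cases "x \<in> V")
      case True
      then show ?thesis using that by (simp add: mult compose_def)
    next
      case False
      then show ?thesis
        using ext[of "g \<otimes> h"] that by (simp add: compose_def extensional_def)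
    qed
  qed
  then have "\<alpha> \<in> hom G (BijGroup V)"
    using bij by (auto simp: hom_def BijGroup_def)
  then show ?thesis
    by (simp add: group_action_def group_hom_def group_hom_axioms_def group_BijGroup)
qed

context group_action
begin

lemma group_G: "group G"
  using group_hom group_hom.axioms(1) by auto

lemma action_one: "x \<in> E \<Longrightarrow> \<phi> \<one> x = x"
  by (metis id_eq_one restrict_apply')

lemma generate_subset_stabilizer:
  assumes "x \<in> E" "A \<subseteq> stabilizer G \<phi> x"
  shows "generate G A \<subseteq> stabilizer G \<phi> x"
  using group.generate_subgroup_incl[OF group_G assms(2) stabilizer_subgroup[OF assms(1)]] .

end

lemma tournament_action_group_action:
  "tournament_action G V R \<alpha> \<Longrightarrow> group_action G V \<alpha>"
  by (simp add: tournament_action_def)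

text \<open>If $h$ moved $x$ while $h^2$ fixes it, then $h$ would swap $x$ and $h x$, and so reverse the arrow
between them. This is why finite groups of automorphisms of tournaments have odd order.\<close>

lemma tournament_action_square_trivial:
  assumes TA: "tournament_action G V R \<alpha>" and h: "h \<in> carrier G"
    and triv: "\<forall>x\<in>V. \<alpha> (h \<otimes>\<^bsub>G\<^esub> h) x = x"
  shows "\<forall>x\<in>V. \<alpha> h x = x"
proof (rule ballI, rule ccontr)
  fix x assume x: "x \<in> V" and ne: "\<alpha> h x \<noteq> x"
  interpret group_action G V \<alpha>
    using TA by (rule tournament_action_group_action)
  have y: "\<alpha> h x \<in> V" using element_image h x by blast
  have h_twice: "\<alpha> h (\<alpha> h x) = x"
    using triv x composition_rule[OF x h h] by simp
  have "(x, \<alpha> h x) \<in> R \<longleftrightarrow> (\<alpha> h x, x) \<in> R"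
    using TA h x y h_twice unfolding tournament_action_def by metis
  then show False
    using TA x y ne unfolding tournament_action_def tournament_def by metis
qed

text \<open>Some positive power of $g$ acts trivially because the permutations of \<open>Y\<close> form a finite group; an
even exponent can be halved repeatedly by the previous lemma until it is odd.\<close>

lemma finite_tournament_action_odd_power_trivial:
  fixes G (structure)
  assumes TA: "tournament_action G Y S \<beta>" and fin: "finite Y" and g: "g \<in> carrier G"
  shows "\<exists>k::nat. \<forall>y\<in>Y. \<beta> (g [^] (2 * k + 1)) y = y"
proof -
  interpret group_action G Y \<beta>
    using TA by (rule tournament_action_group_action)
  interpret group G by (rule group_G)
  interpret B: group "BijGroup Y" by (rule group_BijGroup)
  have "Bij Y \<subseteq> Y \<rightarrow>\<^sub>E Y"
    by (auto simp: Bij_def PiE_def bij_betw_def)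
  then have "finite (carrier (BijGroup Y))"
    using fin by (auto simp: BijGroup_def intro: finite_subset finite_PiE)
  then have pos: "order (BijGroup Y) > 0"
    using B.order_gt_0_iff_finite by blast
  have "\<beta> (g [^] order (BijGroup Y)) = \<one>\<^bsub>BijGroup Y\<^esub>"
    using group_hom.hom_nat_pow[OF group_hom g] B.pow_order_eq_1
      group_hom.hom_closed[OF group_hom g] by simp
  then have "\<forall>y\<in>Y. \<beta> (g [^] order (BijGroup Y)) y = y"
    by (simp add: BijGroup_def)
  moreover have "\<exists>k::nat. \<forall>y\<in>Y. \<beta> (g [^] (2 * k + 1)) y = y"
    if "n > 0" "\<forall>y\<in>Y. \<beta> (g [^] n) y = y" for n :: nat
    using that
  proof (induction n rule: less_induct)
    case (less n)
    show ?case
    proof (cases "even n")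
      case True
      then obtain l where l: "n = l + l" by (metis mult_2 evenE)
      then have "\<forall>y\<in>Y. \<beta> (g [^] l) y = y"
        using tournament_action_square_trivial[OF TA, of "g [^] l"] less.prems g
        by (simp add: nat_pow_mult)
      then show ?thesis using less.IH[of l] less.prems l by simp
    next
      case False
      then show ?thesis using less.prems by (metis oddE)
    qed
  qed
  ultimately show ?thesis using pos by blast
qed

section \<open>Obstructing finite approximations\<close>

text \<open>The obstruction. In a finite tournament some \<open>g [^] (2 * k + 1)\<close> acts trivially, so $g$ acts like an
even power of itself, that is, like a product $pq$ with $p$ fixing the image of $x$ and $q$ fixing the
image of $y$. Then $p$ carries the arrow between $x$ and $y$ to the arrow between $x$ and $g y$, so these
two arrows have the same direction. In \<open>R\<close> they have opposite directions. Only finitely many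
elements matter: that the elements of \<open>A\<close> and \<open>B\<close> fix $x$ and $y$ is recorded by a finite part of the
action.\<close>

lemma (in group) not_finitely_approximableI:
  assumes TA: "tournament_action G V R \<alpha>" and x: "x \<in> V" and y: "y \<in> V"
    and g: "g \<in> carrier G" and xy: "(x, y) \<in> R" and gyx: "(\<alpha> g y, x) \<in> R"
    and A: "finite A" "A \<subseteq> stabilizer G \<alpha> x" and B: "finite B" "B \<subseteq> stabilizer G \<alpha> y"
    and powers: "\<And>k::nat. g [^] (2 * k) \<in> generate G A <#> generate G B"
  shows "\<not> finitely_approximable G V R \<alpha>"
proof
  assume fa: "finitely_approximable G V R \<alpha>"
  interpret V: group_action G V \<alpha>
    using TA by (rule tournament_action_group_action)
  define F where "F = insert \<one> (insert g (A \<union> B))"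
  define D where "D = {\<alpha> f v | f v. f \<in> F \<and> v \<in> {x, y}}"
  have "finite F \<and> F \<subseteq> carrier G \<and> \<one> \<in> F \<and> finite {x, y} \<and> {x, y} \<subseteq> V"
    using A B g x y by (auto simp: F_def stabilizer_def)
  from fa[unfolded finitely_approximable_def Let_def, rule_format, OF this]
  obtain Y :: "nat set" and S \<beta> e where fin: "finite Y" and TB: "tournament_action G Y S \<beta>"
    and eD: "e \<in> D \<rightarrow> Y" and emb: "\<forall>a\<in>D. \<forall>b\<in>D. (a, b) \<in> R \<longleftrightarrow> (e a, e b) \<in> S"
    and eq: "\<forall>f\<in>F. \<forall>v\<in>{x, y}. \<beta> f (e v) = e (\<alpha> f v)"
    unfolding D_def by blast
  interpret Y: group_action G Y \<beta>
    using TB by (rule tournament_action_group_action)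
  have D: "\<alpha> f v \<in> D" if "f \<in> F" "v \<in> {x, y}" for f v
    using that D_def by auto
  have xD: "x \<in> D" and yD: "y \<in> D" and gyD: "\<alpha> g y \<in> D"
    using D[of \<one> x] D[of \<one> y] D[of g y] V.action_one x y by (auto simp: F_def)
  have ex: "e x \<in> Y" and ey: "e y \<in> Y" using eD xD yD by auto
  have "A \<subseteq> stabilizer G \<beta> (e x)" "B \<subseteq> stabilizer G \<beta> (e y)"
    using A B eq by (auto simp: stabilizer_def F_def)
  then have gen: "generate G A \<subseteq> stabilizer G \<beta> (e x)" "generate G B \<subseteq> stabilizer G \<beta> (e y)"
    using Y.generate_subset_stabilizer ex ey by blast+
  obtain k :: nat where k: "\<forall>v\<in>Y. \<beta> (g [^] (2 * k + 1)) v = v"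
    using finite_tournament_action_odd_power_trivial[OF TB fin g] by blast
  \<comment> \<open>The exponent must be even and one more than the odd exponent that acts trivially.\<close>
  obtain p q where p: "p \<in> generate G A" and q: "q \<in> generate G B"
    and pq: "g [^] (2 * (k + 1)) = p \<otimes> q"
    using powers[of "k + 1"] by (auto simp: set_mult_def)
  have p': "p \<in> carrier G" "\<beta> p (e x) = e x" and q': "q \<in> carrier G" "\<beta> q (e y) = e y"
    using p q gen by (auto simp: stabilizer_def)
  have "g [^] (2 * (k + 1)) = g [^] (2 * k + 1) \<otimes> g"
    by simp
  then have "\<beta> (p \<otimes> q) (e y) = \<beta> (g [^] (2 * k + 1)) (\<beta> g (e y))"
    using Y.composition_rule[OF ey _ g] g pq by (metis nat_pow_closed)
  also have "\<dots> = \<beta> g (e y)"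
    using k Y.element_image[OF g ey] by blast
  also have "\<dots> = e (\<alpha> g y)"
    using eq by (simp add: F_def)
  finally have "\<beta> p (e y) = e (\<alpha> g y)"
    using Y.composition_rule[OF ey p'(1) q'(1)] q' by simp
  moreover have "(e x, e y) \<in> S"
    using emb xD yD xy by blast
  then have "(\<beta> p (e x), \<beta> p (e y)) \<in> S"
    using TB p'(1) ex ey unfolding tournament_action_def by blast
  ultimately have "(e x, e (\<alpha> g y)) \<in> S"
    using p' by simp
  then have "(x, \<alpha> g y) \<in> R"
    using emb xD gyD by blast
  with gyx show False
    using TA unfolding tournament_action_def tournament_def by (metis SigmaD1 SigmaD2 subsetD)
qed

text \<open>An invariant tournament is a choice of one orbit from each pair consisting of an orbit of ordered
pairs of distinct points and its reversal; these two are different because no group element swaps two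
points. Numbering the countably many orbits makes the choice: the orbit with the smaller number is the
set of arrows. The orbits of $(x, y)$ and $(g y, x)$ are given priority by the number $0$, which is
consistent because by \<open>sep\<close> neither of them is the reversal of the other, and no orbit of distinct
points is its own reversal.\<close>

lemma (in group_action) ex_invariant_tournament:
  assumes cnt: "countable E"
    and noswap: "\<And>h p q. h \<in> carrier G \<Longrightarrow> p \<in> E \<Longrightarrow> q \<in> E \<Longrightarrow> \<phi> h p = q \<Longrightarrow> \<phi> h q = p \<Longrightarrow> p = q"
    and x: "x \<in> E" and y: "y \<in> E" and g: "g \<in> carrier G"
    and nxy: "\<And>h. h \<in> carrier G \<Longrightarrow> \<phi> h y \<noteq> x"
    and sep: "\<And>h. h \<in> carrier G \<Longrightarrow> \<phi> h x = x \<Longrightarrow> \<phi> h y \<noteq> \<phi> g y"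
  shows "\<exists>R. tournament_action G E R \<phi> \<and> (x, y) \<in> R \<and> (\<phi> g y, x) \<in> R"
proof -
  interpret group G by (rule group_G)
  define orb where "orb p q = {(\<phi> h p, \<phi> h q) | h. h \<in> carrier G}" for p q
  have closed: "\<phi> h p \<in> E" if "h \<in> carrier G" "p \<in> E" for h p
    using that element_image[OF _ _ refl] by simp
  have orb_self: "(p, q) \<in> orb p q" if "p \<in> E" "q \<in> E" for p q
    using action_one[OF that(1)] action_one[OF that(2)] by (auto simp: orb_def intro!: exI[of _ \<one>])
  have orb_eq: "orb (\<phi> h p) (\<phi> h q) = orb p q" if h: "h \<in> carrier G" and "p \<in> E" "q \<in> E" for h p q
  proof
    show "orb (\<phi> h p) (\<phi> h q) \<subseteq> orb p q"
    proof
      fix z assume "z \<in> orb (\<phi> h p) (\<phi> h q)"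
      then obtain f where f: "f \<in> carrier G" "z = (\<phi> f (\<phi> h p), \<phi> f (\<phi> h q))"
        by (auto simp: orb_def)
      then have "z = (\<phi> (f \<otimes> h) p, \<phi> (f \<otimes> h) q)"
        using composition_rule that by simp
      then show "z \<in> orb p q"
        unfolding orb_def using f h by blast
    qed
    show "orb p q \<subseteq> orb (\<phi> h p) (\<phi> h q)"
    proof
      fix z assume "z \<in> orb p q"
      then obtain f where f: "f \<in> carrier G" "z = (\<phi> f p, \<phi> f q)" by (auto simp: orb_def)
      have "\<phi> f r = \<phi> (f \<otimes> inv h) (\<phi> h r)" if "r \<in> E" for r
        using composition_rule[OF that, of "f \<otimes> inv h" h] f h by (simp add: m_assoc)
      then show "z \<in> orb (\<phi> h p) (\<phi> h q)"
        unfolding orb_def using f h that by blast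
    qed
  qed
  define P where "P = {orb x y, orb (\<phi> g y) x}"
  have countable_orbs: "countable (case_prod orb ` (E \<times> E))"
    using cnt by blast
  define key where "key Q = (if Q \<in> P then 0 else Suc (to_nat_on (case_prod orb ` (E \<times> E)) Q))" for Q
  define R where "R = {(p, q). p \<in> E \<and> q \<in> E \<and> p \<noteq> q \<and> key (orb p q) < key (orb q p)}"
  have gy: "\<phi> g y \<in> E" using closed g y by blast
  have orbE: "\<exists>h\<in>carrier G. a = \<phi> h p \<and> b = \<phi> h q" if "(a, b) \<in> orb p q" for a b p q
    using that by (auto simp: orb_def)
  have not_rev: "orb p q \<noteq> orb q p" if pq: "p \<in> E" "q \<in> E" "p \<noteq> q" for p q
  proof
    assume "orb p q = orb q p"
    then have "(p, q) \<in> orb q p" using orb_self[OF pq(1,2)] by simp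
    then obtain h where "h \<in> carrier G" "p = \<phi> h q" "q = \<phi> h p"
      using orbE by blast
    then show False using noswap[of h p q] pq by metis
  qed
  have rev: "orb q p \<notin> P" if pq: "p \<in> E" "q \<in> E" "p \<noteq> q" "orb p q \<in> P" for p q
  proof -
    have not_yx: "orb y x \<notin> P"
    proof -
      have "orb y x \<noteq> orb x y" using not_rev x y nxy[of \<one>] action_one by (metis one_closed)
      moreover have "orb y x \<noteq> orb (\<phi> g y) x"
        using orb_self[OF gy x] orbE[of "\<phi> g y" x y x] sep by metis
      ultimately show ?thesis by (simp add: P_def)
    qed
    have not_xgy: "orb x (\<phi> g y) \<notin> P"
    proof -
      have "orb x (\<phi> g y) \<noteq> orb (\<phi> g y) x"
        using not_rev gy x nxy[OF g] by metis
      moreover have "orb x (\<phi> g y) \<noteq> orb x y"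
        using orb_self[OF x gy] orbE[of x "\<phi> g y" x y] sep by metis
      ultimately show ?thesis by (simp add: P_def)
    qed
    have "orb q p \<in> {orb y x, orb x (\<phi> g y)}"
    proof -
      have swap: "orb q p = orb d c" if "orb p q = orb c d" "c \<in> E" "d \<in> E" for c d
      proof -
        have "(p, q) \<in> orb c d" using orb_self pq that by metis
        then obtain h where "h \<in> carrier G" "p = \<phi> h c" "q = \<phi> h d"
          using orbE by blast
        then show ?thesis using orb_eq[of h c d] orb_eq[of h d c] that by simp
      qed
      show ?thesis using pq(4) swap x y gy by (auto simp: P_def)
    qed
    then show ?thesis using not_yx not_xgy by auto
  qed
  have key_inj: "key (orb p q) \<noteq> key (orb q p)" if pq: "p \<in> E" "q \<in> E" "p \<noteq> q" for p q
  proof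
    assume eq: "key (orb p q) = key (orb q p)"
    have mem: "orb p q \<in> case_prod orb ` (E \<times> E)" "orb q p \<in> case_prod orb ` (E \<times> E)"
      using pq by auto
    have "orb p q \<notin> P" "orb q p \<notin> P"
      using eq rev[of p q] rev[of q p] pq by (auto simp: key_def split: if_splits)
    then have "orb p q = orb q p"
      using eq mem inj_onD[OF inj_on_to_nat_on[OF countable_orbs]] by (simp add: key_def)
    then show False using not_rev[OF pq] by simp
  qed
  have "tournament E R"
    unfolding tournament_def
  proof (intro conjI ballI impI)
    show "((p, q) \<in> R) \<noteq> ((q, p) \<in> R)" if "p \<in> E" "q \<in> E" "p \<noteq> q" for p q
      using key_inj[OF that] that by (auto simp: R_def)
  qed (auto simp: R_def)
  moreover have "(p, q) \<in> R \<longleftrightarrow> (\<phi> h p, \<phi> h q) \<in> R"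
    if "h \<in> carrier G" "p \<in> E" "q \<in> E" for h p q
    using that orb_eq closed inj_prop[of h] by (auto simp: R_def inj_on_eq_iff)
  moreover have "(x, y) \<in> R"
    using rev[of x y] x y nxy[of \<one>] action_one by (auto simp: R_def key_def P_def)
  moreover have "(\<phi> g y, x) \<in> R"
    using rev[of "\<phi> g y" x] x gy nxy[OF g] by (auto simp: R_def key_def P_def)
  ultimately show ?thesis
    using group_action_axioms unfolding tournament_action_def by blast
qed

section \<open>A criterion in terms of two subgroups\<close>

lemma (in group) l_coset_self_iff:
  assumes "subgroup H G" "h \<in> carrier G"
  shows "h <# H = H \<longleftrightarrow> h \<in> H"
proof
  assume "h <# H = H"
  moreover have "h \<in> h <# H"
    using assms subgroup.one_closed[OF assms(1)] by (force simp: l_coset_def)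
  ultimately show "h \<in> H" by simp
qed (use assms coset_join3 in blast)

text \<open>The action is the disjoint union of the left translation actions on $G/H$ and $G/K$; countability of
the two coset spaces lets them be placed inside the given infinite type.\<close>

lemma (in group) ex_action_with_two_stabilizers:
  assumes cnt: "countable (carrier G)" and H: "subgroup H G" and K: "subgroup K G"
  shows "\<exists>(V :: 'x::infinite set) \<alpha> x y. countable V \<and> group_action G V \<alpha> \<and> x \<in> V \<and> y \<in> V \<and>
    stabilizer G \<alpha> x = H \<and> stabilizer G \<alpha> y = K \<and> (\<forall>g\<in>carrier G. \<alpha> g y \<noteq> x) \<and>
    (\<forall>v\<in>V. \<exists>c\<in>carrier G. v = \<alpha> c x \<or> v = \<alpha> c y)"
proof -
  define W where "W = (\<lambda>c. (True, c <# H)) ` carrier G \<union> (\<lambda>c. (False, c <# K)) ` carrier G"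
  have "countable W" using cnt by (simp add: W_def)
  obtain f :: "nat \<Rightarrow> 'x" where f: "inj f"
    using infinite_countable_subset[OF infinite_UNIV] by blast
  define \<iota> where "\<iota> = f \<circ> to_nat_on W"
  have inj: "inj_on \<iota> W"
    unfolding \<iota>_def
    by (rule comp_inj_on[OF inj_on_to_nat_on[OF \<open>countable W\<close>] inj_on_subset[OF f subset_UNIV]])
  define mv where "mv g w = (fst w, g <# snd w)" for g and w :: "bool \<times> 'a set"
  have HG: "H \<subseteq> carrier G" "K \<subseteq> carrier G" using H K subgroup.subset by auto
  have mv_closed: "mv g w \<in> W" if "g \<in> carrier G" "w \<in> W" for g w
    using that HG by (auto simp: W_def mv_def lcos_m_assoc)
  have mv_one: "mv \<one> w = w" if "w \<in> W" for w
    using that HG by (auto simp: W_def mv_def lcos_m_assoc)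
  have mv_mult: "mv (g \<otimes> h) w = mv g (mv h w)" if "g \<in> carrier G" "h \<in> carrier G" "w \<in> W" for g h w
    using that HG by (auto simp: W_def mv_def lcos_m_assoc m_assoc)
  define \<alpha> where "\<alpha> g = restrict (\<lambda>v. \<iota> (mv g (inv_into W \<iota> v))) (\<iota> ` W)" for g
  have \<alpha>: "\<alpha> g (\<iota> w) = \<iota> (mv g w)" if "w \<in> W" for g w
    using that inj by (simp add: \<alpha>_def)
  define w1 where "w1 = (True, H)"
  define w2 where "w2 = (False, K)"
  have w: "w1 \<in> W" "w2 \<in> W"
    using HG by (auto simp: W_def w1_def w2_def lcos_mult_one intro!: image_eqI[of _ _ \<one>])
  have act: "group_action G (\<iota> ` W) \<alpha>"
    by (rule group_actionI[OF is_group])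
      (auto simp: \<alpha> mv_closed mv_one mv_mult, simp add: \<alpha>_def)
  have stab: "stabilizer G \<alpha> (\<iota> w) = {g \<in> carrier G. mv g w = w}" if "w \<in> W" for w
    using that inj by (auto simp: stabilizer_def \<alpha> mv_closed inj_on_eq_iff)
  have sub_stab: "{g \<in> carrier G. mv g (b, L) = (b, L)} = L" if L: "subgroup L G" for b L
    using l_coset_self_iff[OF L] subgroup.mem_carrier[OF L] by (auto simp: mv_def)
  have "stabilizer G \<alpha> (\<iota> w1) = H" "stabilizer G \<alpha> (\<iota> w2) = K"
    using stab[OF w(1)] stab[OF w(2)] sub_stab[OF H] sub_stab[OF K] by (simp_all add: w1_def w2_def)
  moreover have "\<alpha> g (\<iota> w2) \<noteq> \<iota> w1" if "g \<in> carrier G" for g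
  proof -
    have "mv g w2 \<noteq> w1" by (simp add: mv_def w1_def w2_def)
    then show ?thesis
      using inj_onD[OF inj, of "mv g w2" w1] \<alpha>[OF w(2)] mv_closed[OF that w(2)] w by auto
  qed
  moreover have "\<exists>c\<in>carrier G. v = \<alpha> c (\<iota> w1) \<or> v = \<alpha> c (\<iota> w2)" if "v \<in> \<iota> ` W" for v
  proof -
    have "v \<in> \<iota> ` ((\<lambda>c. mv c w1) ` carrier G \<union> (\<lambda>c. mv c w2) ` carrier G)"
      using that by (simp add: W_def mv_def w1_def w2_def)
    then show ?thesis using w by (auto simp: \<alpha>)
  qed
  ultimately show ?thesis
    using act w \<open>countable W\<close>
    by (intro exI[of _ "\<iota> ` W"] exI[of _ \<alpha>] exI[of _ "\<iota> w1"] exI[of _ "\<iota> w2"] conjI ballI)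
      (simp_all only: countable_image imageI simp_thms)
qed

text \<open>Closure of $H$ and $K$ under square roots ensures that on $G/H \cup G/K$ no element swaps two points, and
$g \notin HK$ says that no element fixes the coset $H$ and moves the coset $K$ to $gK$. So the arrows from
$H$ to $K$ and from $gK$ to $H$ can coexist in an invariant tournament, whereas by \<open>powers\<close> they
cannot coexist in a finite approximation.\<close>

lemma (in group) not_finite_approximabilityI:
  assumes cnt: "countable (carrier G)" and H: "subgroup H G" and K: "subgroup K G"
    and sqH: "\<And>s. s \<in> carrier G \<Longrightarrow> s \<otimes> s \<in> H \<Longrightarrow> s \<in> H"
    and sqK: "\<And>s. s \<in> carrier G \<Longrightarrow> s \<otimes> s \<in> K \<Longrightarrow> s \<in> K"
    and A: "finite A" "A \<subseteq> H" and B: "finite B" "B \<subseteq> K"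
    and g: "g \<in> carrier G" "g \<notin> H <#> K"
    and powers: "\<And>k::nat. g [^] (2 * k) \<in> generate G A <#> generate G B"
  shows "\<not> finite_approximability_on_tournaments TYPE('x::infinite) G"
proof -
  obtain V :: "'x set" and \<alpha> x y where cV: "countable V" and act: "group_action G V \<alpha>"
    and x: "x \<in> V" and y: "y \<in> V" and sx: "stabilizer G \<alpha> x = H" and sy: "stabilizer G \<alpha> y = K"
    and nxy: "\<forall>g\<in>carrier G. \<alpha> g y \<noteq> x" and cover: "\<forall>v\<in>V. \<exists>c\<in>carrier G. v = \<alpha> c x \<or> v = \<alpha> c y"
    using ex_action_with_two_stabilizers[OF cnt H K, where ?'x = 'x] by blast
  interpret group_action G V \<alpha> by (rule act)
  have root: "\<alpha> h v = v" if h: "h \<in> carrier G" and v: "v \<in> V" and hv: "\<alpha> (h \<otimes> h) v = v" for h v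
  proof -
    obtain c where c: "c \<in> carrier G" and "v = \<alpha> c x \<or> v = \<alpha> c y"
      using bspec[OF cover v] by blast
    then have "\<exists>z\<in>{x, y}. v = \<alpha> c z" by simp
    then obtain z where z: "z \<in> {x, y}" and vz: "v = \<alpha> c z" ..
    have zV: "z \<in> V" using z x y by auto
    \<comment> \<open>Conjugating by $c$ moves the question to a point whose stabilizer is $H$ or $K$.\<close>
    define s where "s = inv c \<otimes> h \<otimes> c"
    have s: "s \<in> carrier G" using c h by (simp add: s_def)
    have cs: "c \<otimes> s = h \<otimes> c" using c h by (simp add: s_def m_assoc[symmetric])
    have "c \<otimes> (s \<otimes> s) = h \<otimes> h \<otimes> c"
      using c h s cs by (metis m_assoc)
    then have "\<alpha> (c \<otimes> (s \<otimes> s)) z = v"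
      using composition_rule[OF zV, of "h \<otimes> h" c] h c hv vz by simp
    then have "\<alpha> c (\<alpha> (s \<otimes> s) z) = \<alpha> c z"
      using composition_rule[OF zV c, of "s \<otimes> s"] s vz by simp
    moreover have "\<alpha> (s \<otimes> s) z \<in> V" using element_image zV s by blast
    ultimately have "\<alpha> (s \<otimes> s) z = z"
      using inj_prop[OF c] zV by (meson inj_on_eq_iff)
    then have "s \<otimes> s \<in> stabilizer G \<alpha> z" using s by (simp add: stabilizer_def)
    then have "s \<in> stabilizer G \<alpha> z" using z sx sy sqH sqK s by auto
    then have "\<alpha> s z = z" by (simp add: stabilizer_def)
    then have "\<alpha> (c \<otimes> s) z = v" using composition_rule[OF zV c s] vz by simp
    then show ?thesis using cs composition_rule[OF zV h c] vz by simp
  qed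
  have "p = q" if "h \<in> carrier G" "p \<in> V" "q \<in> V" "\<alpha> h p = q" "\<alpha> h q = p" for h p q
    using root[of h p] that composition_rule[of p h h] by simp
  moreover have "\<alpha> h y \<noteq> \<alpha> g y" if h: "h \<in> carrier G" "\<alpha> h x = x" for h
  proof
    assume "\<alpha> h y = \<alpha> g y"
    then have "\<alpha> (inv h \<otimes> g) y = y"
      using composition_rule[OF y, of "inv h" g] orbit_sym_aux[OF h(1) y] h g by simp
    then have "inv h \<otimes> g \<in> K" using sy h g by (auto simp: stabilizer_def)
    moreover have "h \<in> H" using sx h by (auto simp: stabilizer_def)
    moreover have "g = h \<otimes> (inv h \<otimes> g)" using h g by (simp add: m_assoc[symmetric])
    ultimately show False using g(2) by (auto simp: set_mult_def)
  qed
  ultimately have "\<exists>R. tournament_action G V R \<alpha> \<and> (x, y) \<in> R \<and> (\<alpha> g y, x) \<in> R"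
    using nxy by (intro ex_invariant_tournament[OF cV _ x y g(1)]) blast+
  then obtain R where R: "tournament_action G V R \<alpha>" "(x, y) \<in> R" "(\<alpha> g y, x) \<in> R"
    by blast
  have "\<not> finitely_approximable G V R \<alpha>"
    using not_finitely_approximableI[OF R(1) x y g(1) R(2,3) A(1) _ B(1) _ powers] A B sx sy by simp
  then show ?thesis
    using R(1) unfolding finite_approximability_on_tournaments_def by blast
qed

section \<open>Groups with a quotient isomorphic to the square of the integers\<close>

lemma nat_pow_integer_group_pair:
  "p [^]\<^bsub>integer_group \<times>\<times> integer_group\<^esub> (n::nat) = (int n * fst p, int n * snd p)"
  by (induction n) (simp_all add: mult_DirProd' algebra_simps)

text \<open>Take for $H$ and $K$ the preimages of the diagonal and the antidiagonal of \<open>\<int>\<^sup>2\<close>. Both are closed under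
square roots, but their sum has index $2$, and $g$ over $(1, 0)$ lies outside of it. The even powers
of $g$ do lie in it: if $a$ and $b$ lie over $(1, 1)$ and $(1, -1)$, then $g^{2k} = a^k b^k n$ with $n$ in the
kernel. Finite generation of the kernel lets a finite set generate all these factors.\<close>

lemma (in group) not_finite_approximability_if_hom_onto_Z2:
  assumes cnt: "countable (carrier G)"
    and hom: "\<phi> \<in> hom G (integer_group \<times>\<times> integer_group)" and onto: "\<phi> ` carrier G = UNIV"
    and S: "finite S" "S \<subseteq> carrier G" and ker: "{x \<in> carrier G. \<phi> x = (0, 0)} = generate G S"
  shows "\<not> finite_approximability_on_tournaments TYPE('x::infinite) G"
proof -
  let ?Z = "integer_group \<times>\<times> integer_group"
  interpret Z: group ?Z by (simp add: DirProd_group)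
  interpret \<phi>: group_hom G ?Z \<phi>
    using hom by unfold_locales
  have mult: "\<phi> (x \<otimes> y) = (fst (\<phi> x) + fst (\<phi> y), snd (\<phi> x) + snd (\<phi> y))"
    if "x \<in> carrier G" "y \<in> carrier G" for x y
    using that by (simp add: mult_DirProd')
  have inv: "\<phi> (inv x) = (- fst (\<phi> x), - snd (\<phi> x))" if x: "x \<in> carrier G" for x
  proof -
    have "\<phi> (inv x \<otimes> x) = (0, 0)" using x by (simp del: \<phi>.hom_mult)
    then show ?thesis
      using mult[of "inv x" x] x by (auto simp: prod_eq_iff)
  qed
  have pow: "\<phi> (x [^] n) = (int n * fst (\<phi> x), int n * snd (\<phi> x))" if "x \<in> carrier G" for x and n :: nat
    using that by (simp only: \<phi>.hom_nat_pow nat_pow_integer_group_pair)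
  have one: "\<phi> \<one> = (0, 0)" by simp
  define H where "H = {x \<in> carrier G. fst (\<phi> x) = snd (\<phi> x)}"
  define K where "K = {x \<in> carrier G. fst (\<phi> x) = - snd (\<phi> x)}"
  have subH: "subgroup H G"
    by (rule subgroupI) (use one in \<open>auto simp: H_def mult inv simp del: \<phi>.hom_mult \<phi>.hom_inv\<close>)
  have subK: "subgroup K G"
    by (rule subgroupI) (use one in \<open>auto simp: K_def mult inv simp del: \<phi>.hom_mult \<phi>.hom_inv\<close>)
  have "\<exists>g\<in>carrier G. \<phi> g = p" for p
    using onto by (metis UNIV_I imageE)
  then obtain g a b where g: "g \<in> carrier G" "\<phi> g = (1, 0)" and a: "a \<in> carrier G" "\<phi> a = (1, 1)"
    and b: "b \<in> carrier G" "\<phi> b = (1, -1)" by metis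
  have genS: "\<phi> x = (0, 0)" if "x \<in> S" for x
    using ker generate.incl[OF that] by blast
  show ?thesis
  proof (rule not_finite_approximabilityI[OF cnt subH subK, of "{a}" "insert b S" g])
    show "s \<in> H" if "s \<in> carrier G" "s \<otimes> s \<in> H" for s
      using that by (simp add: H_def mult del: \<phi>.hom_mult)
    show "s \<in> K" if "s \<in> carrier G" "s \<otimes> s \<in> K" for s
      using that by (simp add: K_def mult del: \<phi>.hom_mult)
    show "finite {a}" "finite (insert b S)" "{a} \<subseteq> H" "insert b S \<subseteq> K" "g \<in> carrier G"
      using S a b g genS by (auto simp: H_def K_def)
    show "g \<notin> H <#> K"
    proof
      assume "g \<in> H <#> K"
      then obtain h k where h: "h \<in> H" and k: "k \<in> K" and "g = h \<otimes> k"
        by (auto simp: set_mult_def)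
      then have "\<phi> g = (fst (\<phi> h) + fst (\<phi> k), snd (\<phi> h) + snd (\<phi> k))"
        using mult by (simp add: H_def K_def)
      then have "1 = fst (\<phi> h) + fst (\<phi> k)" "0 = snd (\<phi> h) + snd (\<phi> k)"
        using g by simp_all
      then show False using h k by (simp add: H_def K_def) presburger
    qed
    fix k :: nat
    have gen: "subgroup (generate G (insert b S)) G"
      using S b by (intro generate_is_subgroup) auto
    define n where "n = inv (b [^] k) \<otimes> (inv (a [^] k) \<otimes> g [^] (2 * k))"
    have n: "n \<in> carrier G" "\<phi> n = (0, 0)"
      using a b g by (simp_all add: n_def mult inv pow del: \<phi>.hom_mult \<phi>.hom_inv)
    have "n \<in> generate G S" using ker n by auto
    then have "n \<in> generate G (insert b S)"
      using mono_generate[of S "insert b S"] by auto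
    moreover have "b [^] k \<in> generate G (insert b S)"
      using subgroup_int_pow_closed[OF gen generate.incl, of b "int k"] by (simp add: int_pow_int)
    ultimately have "b [^] k \<otimes> n \<in> generate G (insert b S)"
      using subgroup.m_closed[OF gen] by blast
    moreover have "a [^] k \<in> generate G {a}"
      using generate_pow[OF a(1)] int_pow_int[of G a k] by (metis (mono_tags, lifting) UNIV_I mem_Collect_eq)
    moreover have "g [^] (2 * k) = a [^] k \<otimes> (b [^] k \<otimes> n)"
    proof -
      have "b [^] k \<otimes> n = inv (a [^] k) \<otimes> g [^] (2 * k)"
        using a b g by (simp add: n_def m_assoc[symmetric])
      then show ?thesis using a g by (simp add: m_assoc[symmetric])
    qed
    ultimately show "g [^] (2 * k) \<in> generate G {a} <#> generate G (insert b S)"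
      unfolding set_mult_def by blast
  qed
qed

lemma (in group) normal_is_kernel:
  assumes "N \<lhd> G"
  shows "group_hom G (G Mod N) ((#>) N)"
    and "\<And>x. x \<in> carrier G \<Longrightarrow> N #> x = \<one>\<^bsub>G Mod N\<^esub> \<longleftrightarrow> x \<in> N"
proof -
  interpret normal N G by fact
  show "group_hom G (G Mod N) ((#>) N)"
    using r_coset_hom_Mod factorgroup_is_group is_group
    by (simp add: group_hom_def group_hom_axioms_def)
  show "N #> x = \<one>\<^bsub>G Mod N\<^esub> \<longleftrightarrow> x \<in> N" if "x \<in> carrier G" for x
    using that rcos_self[OF that is_subgroup] coset_join2[OF that is_subgroup]
    by (auto simp: FactGroup_def)
qed

lemma (in group) not_finite_approximability_if_Mod_iso_Z2:
  assumes cnt: "countable (carrier G)" and N: "N \<lhd> G" and fg: "fin_gen_subgroup G N"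
    and iso: "G Mod N \<cong> integer_group \<times>\<times> integer_group"
  shows "\<not> finite_approximability_on_tournaments TYPE('x::infinite) G"
proof -
  let ?Z = "integer_group \<times>\<times> integer_group"
  interpret Z: group ?Z by (simp add: DirProd_group)
  define Q where "Q = G Mod N"
  define p where "p = (#>) N"
  interpret p: group_hom G Q p
    unfolding Q_def p_def by (rule normal_is_kernel(1)[OF N])
  have one: "p x = \<one>\<^bsub>Q\<^esub> \<longleftrightarrow> x \<in> N" if "x \<in> carrier G" for x
    unfolding Q_def p_def by (rule normal_is_kernel(2)[OF N that])
  have img: "p ` carrier G = carrier Q"
    by (auto simp: Q_def p_def FactGroup_def RCOSETS_def)
  obtain \<psi> where \<psi>: "\<psi> \<in> iso Q ?Z" using iso by (auto simp: is_iso_def Q_def)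
  have hom: "\<psi> \<circ> p \<in> hom G ?Z"
    using Group.hom_compose[OF p.homh, of \<psi> ?Z] \<psi> by (simp add: iso_def)
  have bij: "bij_betw \<psi> (carrier Q) UNIV"
    using \<psi> by (simp add: iso_def)
  have onto: "(\<psi> \<circ> p) ` carrier G = UNIV"
    unfolding image_comp[symmetric] img using bij by (simp add: bij_betw_def)
  have "\<psi> \<one>\<^bsub>Q\<^esub> = (0, 0)"
    using hom_one[of \<psi> Q ?Z] \<psi> p.H.is_group Z.is_group by (simp add: iso_def)
  then have "\<psi> (p x) = (0, 0) \<longleftrightarrow> x \<in> N" if "x \<in> carrier G" for x
    using inj_on_eq_iff[OF bij_betw_imp_inj_on[OF bij], of "p x" "\<one>\<^bsub>Q\<^esub>"] one[OF that] that by simp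
  moreover have "N \<subseteq> carrier G" using normal_imp_subgroup[OF N] by (rule subgroup.subset)
  ultimately have ker: "{x \<in> carrier G. (\<psi> \<circ> p) x = (0, 0)} = N"
    by auto
  obtain S where "finite S" "S \<subseteq> carrier G" "N = generate G S"
    using fg by (auto simp: fin_gen_subgroup_def)
  then show ?thesis
    using not_finite_approximability_if_hom_onto_Z2[OF cnt hom onto] ker by blast
qed

section \<open>Roots in torsion-free nilpotent groups\<close>

context group
begin

lemma centralizer_subgroup:
  assumes "t \<in> carrier G"
  shows "subgroup {x \<in> carrier G. x \<otimes> t = t \<otimes> x} G" (is "subgroup ?C G")
proof (rule subgroupI)
  show "?C \<subseteq> carrier G" by blast
  show "?C \<noteq> {}" using assms by auto
  fix x assume x: "x \<in> ?C"
  show "inv x \<in> ?C"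
  proof -
    have xG: "x \<in> carrier G" using x by simp
    have "t \<otimes> inv x = inv x \<otimes> (x \<otimes> t) \<otimes> inv x"
      using xG assms by (simp add: m_assoc[symmetric])
    also have "\<dots> = inv x \<otimes> (t \<otimes> x) \<otimes> inv x" using x by simp
    also have "\<dots> = inv x \<otimes> t" using xG assms by (simp add: m_assoc)
    finally show ?thesis using x by simp
  qed
  fix y assume y: "y \<in> ?C"
  have "x \<otimes> y \<otimes> t = t \<otimes> (x \<otimes> y)"
    using x y assms by (metis (mono_tags, lifting) m_assoc mem_Collect_eq)
  then show "x \<otimes> y \<in> ?C" using x y by simp
qed

lemma commutes_int_pow:
  assumes "x \<in> carrier G" "t \<in> carrier G" "x \<otimes> t = t \<otimes> x"
  shows "x [^] (i::int) \<otimes> t = t \<otimes> x [^] i"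
  using subgroup_int_pow_closed[OF centralizer_subgroup[OF assms(2)], of x i] assms by simp

text \<open>If $a$ commutes with $c = [a, b]$, then $[a^n, b] = c^n$; the commutator is written without inverses.\<close>

lemma pow_past_commutator:
  assumes "a \<in> carrier G" "b \<in> carrier G" "c \<in> carrier G"
    and ab: "a \<otimes> b = c \<otimes> b \<otimes> a" and ac: "a \<otimes> c = c \<otimes> a"
  shows "a [^] n \<otimes> b = c [^] n \<otimes> b \<otimes> a [^] (n::nat)"
proof (induction n)
  case (Suc n)
  have comm: "a [^] n \<otimes> c = c \<otimes> a [^] n"
    using group_commutes_pow[OF ac] assms by simp
  have "a [^] Suc n \<otimes> b = a [^] n \<otimes> (a \<otimes> b)"
    using assms by (simp add: m_assoc)
  also have "\<dots> = (a [^] n \<otimes> c) \<otimes> (b \<otimes> a)"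
    unfolding ab using assms by (simp add: m_assoc)
  also have "\<dots> = c \<otimes> (a [^] n \<otimes> b) \<otimes> a"
    unfolding comm using assms by (simp add: m_assoc)
  also have "\<dots> = c [^] Suc n \<otimes> b \<otimes> a [^] Suc n"
    unfolding Suc.IH nat_pow_Suc2[OF assms(3)] using assms by (simp add: m_assoc)
  finally show ?case .
qed (use assms in simp)

lemma commutator_eq_iff:
  assumes "g \<in> carrier G" "h \<in> carrier G" "c \<in> carrier G"
  shows "g \<otimes> h \<otimes> inv g \<otimes> inv h = c \<longleftrightarrow> g \<otimes> h = c \<otimes> h \<otimes> g"
proof
  assume *: "g \<otimes> h \<otimes> inv g \<otimes> inv h = c"
  show "g \<otimes> h = c \<otimes> h \<otimes> g"
    unfolding *[symmetric] using assms by (simp add: m_assoc inv_solve_left)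
next
  assume "g \<otimes> h = c \<otimes> h \<otimes> g"
  then have "g \<otimes> h \<otimes> inv g \<otimes> inv h = c \<otimes> h \<otimes> g \<otimes> inv g \<otimes> inv h" by simp
  then show "g \<otimes> h \<otimes> inv g \<otimes> inv h = c" using assms by (simp add: m_assoc)
qed

lemma lower_central_subgroup: "subgroup (lower_central G n) G"
proof (induction n)
  case (Suc n)
  then show ?case
    by (auto intro!: generate_is_subgroup dest: subgroup.mem_carrier)
qed (simp add: subgroup_self)

lemma lower_central_carrier: "x \<in> lower_central G n \<Longrightarrow> x \<in> carrier G"
  using lower_central_subgroup subgroup.mem_carrier by metis

lemma commutator_in_lower_central:
  assumes "g \<in> lower_central G n" "h \<in> carrier G"
  shows "g \<otimes> h \<otimes> inv g \<otimes> inv h \<in> lower_central G (Suc n)"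
  using assms by (auto intro!: generate.incl)

lemma lower_central_decreasing: "lower_central G (Suc n) \<subseteq> lower_central G n"
proof (induction n)
  case 0
  show ?case
    using subgroup.subset[OF lower_central_subgroup[of "Suc 0"]] unfolding lower_central.simps(1) .
next
  case (Suc n)
  have "{g \<otimes> h \<otimes> inv g \<otimes> inv h | g h. g \<in> lower_central G (Suc n) \<and> h \<in> carrier G}
      \<subseteq> {g \<otimes> h \<otimes> inv g \<otimes> inv h | g h. g \<in> lower_central G n \<and> h \<in> carrier G}"
    using Suc.IH by blast
  then show ?case
    using mono_generate by (simp only: lower_central.simps(2))
qed

lemma lower_central_normal: "lower_central G n \<lhd> G"
proof (rule normal_invI[OF lower_central_subgroup])
  fix h g assume hg: "h \<in> carrier G" "g \<in> lower_central G n"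
  have g: "g \<in> carrier G" using lower_central_carrier hg by blast
  have "g \<otimes> h \<otimes> inv g \<otimes> inv h \<in> lower_central G n"
    using commutator_in_lower_central[OF hg(2,1)] lower_central_decreasing by blast
  then have "inv (g \<otimes> h \<otimes> inv g \<otimes> inv h) \<otimes> g \<in> lower_central G n"
    using subgroup.m_closed[OF lower_central_subgroup subgroup.m_inv_closed[OF lower_central_subgroup]] hg(2)
    by simp
  moreover have "inv (g \<otimes> h \<otimes> inv g \<otimes> inv h) \<otimes> g = h \<otimes> g \<otimes> inv h"
    using g hg by (simp add: inv_mult_group m_assoc)
  ultimately show "h \<otimes> g \<otimes> inv h \<in> lower_central G n" by simp
qed

lemma lower_central_1: "lower_central G (Suc 0) = derived G (carrier G)"
proof -
  have "{g \<otimes> h \<otimes> inv g \<otimes> inv h | g h. g \<in> carrier G \<and> h \<in> carrier G} = derived_set G (carrier G)"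
    by blast
  then show ?thesis by (simp add: derived_def)
qed

text \<open>The last nontrivial term of the lower central series is central.\<close>

lemma nilpotent_ex_central:
  assumes "nilpotent G" "carrier G \<noteq> {\<one>}"
  shows "\<exists>z\<in>carrier G. z \<noteq> \<one> \<and> (\<forall>x\<in>carrier G. z \<otimes> x = x \<otimes> z)"
proof -
  obtain c where c: "lower_central G c = {\<one>}" using assms(1) by (auto simp: nilpotent_def)
  have "\<exists>i. lower_central G i \<noteq> {\<one>} \<and> lower_central G (Suc i) = {\<one>}"
  proof (rule ccontr)
    assume "\<not> ?thesis"
    then have "lower_central G i \<noteq> {\<one>}" for i
      by (induction i) (use assms(2) in auto)
    then show False using c by blast
  qed
  then obtain i where i: "lower_central G i \<noteq> {\<one>}" "lower_central G (Suc i) = {\<one>}" by blast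
  obtain z where z: "z \<in> lower_central G i" "z \<noteq> \<one>"
    using i(1) subgroup.one_closed[OF lower_central_subgroup] by blast
  have zG: "z \<in> carrier G" using z lower_central_carrier by blast
  have "z \<otimes> x = x \<otimes> z" if x: "x \<in> carrier G" for x
    using commutator_in_lower_central[OF z(1) x] commutator_eq_iff[OF zG x one_closed] i(2) zG x
    by simp
  then show ?thesis using zG z by blast
qed

lemma torsion_free_int_pow:
  assumes "torsion_free G" "x \<in> carrier G" "x [^] (i::int) = \<one>" "i \<noteq> 0"
  shows "x = \<one>"
proof -
  have "x [^] \<bar>i\<bar> = \<one>"
    using assms(2,3) by (simp add: abs_if int_pow_neg)
  then have "x [^] nat \<bar>i\<bar> = \<one>" by (simp add: pow_nat)
  then show ?thesis
    using assms unfolding torsion_free_def by (metis zero_less_nat_eq zero_less_abs_iff)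
qed

text \<open>Downward induction along the lower central series: for $y$ in some term, the commutator $d = [x, y]$ lies
in the next term, and $x^n$ commutes with $d$ because it commutes with $x$ and $y$. So $x$ commutes with
$d$ by induction, whence $d^n = [x^n, y] = 1$, and $d = 1$ as there is no torsion.\<close>

lemma commutes_if_pow_commutes:
  assumes tf: "torsion_free G" and nil: "nilpotent G" and x: "x \<in> carrier G" and y: "y \<in> carrier G"
    and n: "n > 0" and eq: "x [^] (n::nat) \<otimes> y = y \<otimes> x [^] n"
  shows "x \<otimes> y = y \<otimes> x"
proof -
  obtain c where c: "lower_central G c = {\<one>}" using nil by (auto simp: nilpotent_def)
  \<comment> \<open>For \<open>j \<ge> c\<close> the truncated difference stays at the whole group.\<close>
  have "\<forall>y\<in>lower_central G (c - j). x [^] n \<otimes> y = y \<otimes> x [^] n \<longrightarrow> x \<otimes> y = y \<otimes> x" for j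
  proof (induction j)
    case 0
    show ?case using c x by simp
  next
    case (Suc j)
    show ?case
    proof (cases "j < c")
      case False
      then show ?thesis using Suc.IH by simp
    next
      case True
      show ?thesis
      proof (intro ballI impI)
        fix y assume yL: "y \<in> lower_central G (c - Suc j)" and eq: "x [^] n \<otimes> y = y \<otimes> x [^] n"
        have y: "y \<in> carrier G" using yL lower_central_carrier by blast
        \<comment> \<open>The series is built from commutators with its elements on the left, hence the inverse.\<close>
        define d where "d = inv (y \<otimes> x \<otimes> inv y \<otimes> inv x)"
        have d_eq: "d = x \<otimes> y \<otimes> inv x \<otimes> inv y"
          using x y by (simp add: d_def inv_mult_group m_assoc)
        have dG: "d \<in> carrier G" using x y by (simp add: d_def)
        have "Suc (c - Suc j) = c - j" using True by (rule Suc_diff_Suc)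
        then have "y \<otimes> x \<otimes> inv y \<otimes> inv x \<in> lower_central G (c - j)"
          using commutator_in_lower_central[OF yL x] by (simp only:)
        then have dL: "d \<in> lower_central G (c - j)"
          unfolding d_def by (rule subgroup.m_inv_closed[OF lower_central_subgroup])
        define C where "C = {z \<in> carrier G. z \<otimes> x [^] n = x [^] n \<otimes> z}"
        have C: "subgroup C G"
          unfolding C_def using centralizer_subgroup[OF nat_pow_closed[OF x]] .
        have "x \<in> C" unfolding C_def using nat_pow_Suc2[OF x, of n] x by simp
        moreover have "y \<in> C" unfolding C_def using y eq by simp
        ultimately have "d \<in> C"
          unfolding d_eq by (intro subgroup.m_closed[OF C] subgroup.m_inv_closed[OF C])
        then have "d \<otimes> x [^] n = x [^] n \<otimes> d" unfolding C_def by blast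
        then have "x \<otimes> d = d \<otimes> x" using Suc.IH dL by metis
        then have "x [^] n \<otimes> y = d [^] n \<otimes> y \<otimes> x [^] n"
          using pow_past_commutator[OF x y dG] commutator_eq_iff[OF x y dG] d_eq by simp
        then have "d [^] n \<otimes> (y \<otimes> x [^] n) = \<one> \<otimes> (y \<otimes> x [^] n)"
          using eq x y dG by (simp add: m_assoc)
        then have "d [^] n = \<one>"
          using x y dG by (meson r_cancel nat_pow_closed m_closed one_closed)
        then have "d = \<one>" using tf n dG unfolding torsion_free_def by metis
        then show "x \<otimes> y = y \<otimes> x"
          using commutator_eq_iff[OF x y dG] d_eq x y by simp
      qed
    qed
  qed
  from this[of c] show ?thesis using y eq by simp
qed

lemma commutes_if_int_pow_commutes:
  assumes "torsion_free G" "nilpotent G" "x \<in> carrier G" "y \<in> carrier G"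
    and "i \<noteq> 0" and eq: "x [^] (i::int) \<otimes> y = y \<otimes> x [^] i"
  shows "x \<otimes> y = y \<otimes> x"
proof (rule commutes_if_pow_commutes[OF assms(1-4), of "nat \<bar>i\<bar>"])
  show "0 < nat \<bar>i\<bar>" using assms(5) by simp
  have "(x [^] i) [^] sgn i \<otimes> y = y \<otimes> (x [^] i) [^] sgn i"
    using commutes_int_pow[of "x [^] i" y] assms by simp
  then have "x [^] \<bar>i\<bar> \<otimes> y = y \<otimes> x [^] \<bar>i\<bar>"
    using assms(3) by (simp add: int_pow_pow abs_sgn mult.commute)
  then show "x [^] nat \<bar>i\<bar> \<otimes> y = y \<otimes> x [^] nat \<bar>i\<bar>"
    by (simp add: pow_nat)
qed

lemma int_roots_unique:
  assumes tf: "torsion_free G" and nil: "nilpotent G" and x: "x \<in> carrier G" and y: "y \<in> carrier G"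
    and i: "i \<noteq> 0" and eq: "x [^] (i::int) = y [^] i"
  shows "x = y"
proof -
  have "x \<otimes> y = y \<otimes> x"
    using commutes_if_int_pow_commutes[OF tf nil x y i] eq commutes_int_pow[OF y y refl] by simp
  then have "inv y \<otimes> x = x \<otimes> inv y"
    using subgroup.m_inv_closed[OF centralizer_subgroup[OF x], of y] x y by simp
  then have "(x \<otimes> inv y) [^] i = x [^] i \<otimes> inv (y [^] i)"
    using int_pow_mult_distrib[of x "inv y" i] x y int_pow_inv by simp
  then have "(x \<otimes> inv y) [^] i = \<one>" using eq x y by simp
  then have "x \<otimes> inv y = \<one>"
    using torsion_free_int_pow[OF tf _ _ i] x y by simp
  then show ?thesis using x y by (metis inv_closed inv_equality inv_inv)
qed

end

section \<open>Elements that are not squares\<close>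

text \<open>A finitely generated abelian group in which everything is a square has finite exponent. When a generator
$a$ is added to the subgroup $B$ generated by $S$, writing $a$ as the square of $b a^k$ gives
$a^{1 - 2k} = b^2 \in B$. As $m = 1 - 2k$ is odd, it is not zero, and squares of $B$ can be extracted inside
$B$: if $x = y^2$, then $x = x^m x^{2k} = (y^m x^k)^2$, and $y^m \in B$. So the induction hypothesis
applies to $B$.\<close>

lemma (in group) ex_finite_exponent_if_all_squares:
  assumes "comm_group G"
  shows "finite S \<Longrightarrow> S \<subseteq> carrier G \<Longrightarrow> (\<And>x. x \<in> generate G S \<Longrightarrow> \<exists>y\<in>generate G S. x = y \<otimes> y) \<Longrightarrow>
    \<exists>m::int. m \<noteq> 0 \<and> (\<forall>x\<in>generate G S. x [^] m = \<one>)"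
proof (induction S rule: finite_induct)
  case empty
  then show ?case using generate_empty by (intro exI[of _ 1]) auto
next
  case (insert a S)
  interpret comm_group G by fact
  have a: "a \<in> carrier G" and S: "S \<subseteq> carrier G" using insert.prems by auto
  let ?B = "generate G S"
  interpret B: subgroup ?B G using generate_is_subgroup[OF S] .
  have Bpow: "x [^] (k::int) \<in> ?B" if "x \<in> ?B" for x k
    using subgroup_int_pow_closed[OF B.subgroup_axioms that] .
  have split: "\<exists>b\<in>?B. \<exists>k::int. x = b \<otimes> a [^] k" if "x \<in> generate G (insert a S)" for x
    using that
  proof (induction rule: generate.induct)
    case one
    show ?case by (intro bexI[of _ \<one>] exI[of _ 0]) auto
  next
    case (incl h)
    show ?case
    proof (cases "h = a")
      case True
      then show ?thesis using a by (intro bexI[of _ \<one>] exI[of _ 1]) auto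
    next
      case False
      then have "h \<in> ?B" using incl generate.incl by auto
      then show ?thesis by (intro bexI[of _ h] exI[of _ 0]) auto
    qed
  next
    case (inv h)
    show ?case
    proof (cases "h = a")
      case True
      then show ?thesis using a by (intro bexI[of _ \<one>] exI[of _ "-1"]) (auto simp: int_pow_neg)
    next
      case False
      then have "inv h \<in> ?B" using inv generate.inv by auto
      then show ?thesis by (intro bexI[of _ "inv h"] exI[of _ 0]) auto
    qed
  next
    case (eng h1 h2)
    then obtain b c and k l :: int where bc: "b \<in> ?B" "c \<in> ?B" "h1 = b \<otimes> a [^] k" "h2 = c \<otimes> a [^] l"
      by blast
    then have "h1 \<otimes> h2 = (b \<otimes> c) \<otimes> a [^] (k + l)"
      using a by (simp add: int_pow_mult m_ac)
    then show ?case using bc by blast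
  qed
  have sub: "?B \<subseteq> generate G (insert a S)" by (rule mono_generate) blast
  have carr: "generate G (insert a S) \<subseteq> carrier G"
    using generate_incl insert.prems(1) by blast
  obtain y where y: "y \<in> generate G (insert a S)" "a = y \<otimes> y"
    using insert.prems(2)[of a] generate.incl[of a "insert a S"] by auto
  obtain b k where b: "b \<in> ?B" "y = b \<otimes> a [^] (k::int)" using split[OF y(1)] by blast
  define m where "m = 1 - 2 * k"
  have "m \<noteq> 0" unfolding m_def by presburger
  have "a = (b \<otimes> b) \<otimes> a [^] (2 * k)"
    using y(2) unfolding b(2) mult_2 int_pow_mult[OF a] using a b(1) by (simp add: m_ac)
  then have "a [^] m = b \<otimes> b"
    using a b(1) unfolding m_def int_pow_diff[OF a] by (metis B.m_closed B.mem_carrier int_pow_1 int_pow_closed inv_solve_right)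
  then have am: "a [^] m \<in> ?B" using b by simp
  have pm: "x [^] m \<in> ?B" if "x \<in> generate G (insert a S)" for x
  proof -
    obtain b k where b: "b \<in> ?B" "x = b \<otimes> a [^] (k::int)" using split[OF \<open>x \<in> _\<close>] by blast
    have "x [^] m = b [^] m \<otimes> (a [^] m) [^] k"
      unfolding b(2) using a b(1) by (simp add: int_pow_distrib int_pow_pow mult.commute)
    then show ?thesis using Bpow[OF b(1)] Bpow[OF am] by simp
  qed
  have "\<exists>z\<in>?B. x = z \<otimes> z" if x: "x \<in> ?B" for x
  proof -
    obtain y where y: "y \<in> generate G (insert a S)" "x = y \<otimes> y"
      using insert.prems(2) x sub by blast
    have xG: "x \<in> carrier G" and yG: "y \<in> carrier G" using x y carr by auto
    define z where "z = y [^] m \<otimes> x [^] k"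
    have "x [^] m = y [^] m \<otimes> y [^] m"
      using y(2) yG by (simp add: int_pow_distrib)
    then have "z \<otimes> z = x [^] m \<otimes> x [^] (2 * k)"
      unfolding z_def mult_2 int_pow_mult[OF xG] using xG yG by (simp add: m_ac)
    also have "\<dots> = x" using xG by (simp add: m_def int_pow_mult[symmetric])
    finally show ?thesis using pm[OF y(1)] Bpow[OF x] by (intro bexI[of _ z]) (auto simp: z_def)
  qed
  then obtain l :: int where l: "l \<noteq> 0" "\<forall>x\<in>?B. x [^] l = \<one>"
    using insert.IH[OF S] by blast
  have "x [^] (m * l) = \<one>" if "x \<in> generate G (insert a S)" for x
    using pm[OF that] l(2) carr that by (auto simp: int_pow_pow[symmetric])
  then show ?case using l(1) \<open>m \<noteq> 0\<close> by (intro exI[of _ "m * l"]) auto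
qed

context group
begin

text \<open>Modulo the term after the next one, the commutator $[g, h]$ is central and $[g, h]^m = [g^m, h]$. The latter is
trivial, since $g^m$ already lies in a term that is central modulo that one. The $m$-th power is
multiplicative on central elements, so it suffices to treat these generators.\<close>

lemma lower_central_pow_Suc:
  assumes pow: "\<forall>x\<in>lower_central G i. x [^] (m::nat) \<in> lower_central G (Suc i)"
  shows "\<forall>x\<in>lower_central G (Suc i). x [^] m \<in> lower_central G (Suc (Suc i))"
proof -
  let ?M = "lower_central G (Suc (Suc i))" and ?L = "lower_central G (Suc i)"
  define Q where "Q = G Mod ?M"
  define p where "p = (#>) ?M"
  interpret p: group_hom G Q p
    unfolding Q_def p_def by (rule normal_is_kernel(1)[OF lower_central_normal])
  have one: "p x = \<one>\<^bsub>Q\<^esub> \<longleftrightarrow> x \<in> ?M" if "x \<in> carrier G" for x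
    unfolding Q_def p_def by (rule normal_is_kernel(2)[OF lower_central_normal that])
  have central: "p x \<otimes>\<^bsub>Q\<^esub> p y = p y \<otimes>\<^bsub>Q\<^esub> p x" if x: "x \<in> ?L" and y: "y \<in> carrier G" for x y
  proof -
    have xG: "x \<in> carrier G" using x lower_central_carrier by blast
    define c where "c = x \<otimes> y \<otimes> inv x \<otimes> inv y"
    have c: "c \<in> carrier G" "c \<in> ?M"
      using xG y commutator_in_lower_central[OF x y] unfolding c_def by blast+
    have "p (x \<otimes> y) = p (c \<otimes> y \<otimes> x)"
      using commutator_eq_iff[OF xG y c(1)] c_def by simp
    moreover have "p c = \<one>\<^bsub>Q\<^esub>" using one c by blast
    ultimately show ?thesis using xG y c(1) by simp
  qed
  let ?C = "{x \<in> carrier G. x \<in> ?L \<and> x [^] m \<in> ?M}"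
  have pm: "x [^] m \<in> ?M \<longleftrightarrow> p x [^]\<^bsub>Q\<^esub> m = \<one>\<^bsub>Q\<^esub>" if "x \<in> carrier G" for x
    using one[of "x [^] m"] that p.hom_nat_pow by simp
  have "subgroup ?C G"
  proof (rule subgroupI)
    show "?C \<noteq> {}"
      using subgroup.one_closed[OF lower_central_subgroup] by (auto simp del: lower_central.simps intro!: exI[of _ \<one>])
    fix x assume x: "x \<in> ?C"
    then show "inv x \<in> ?C"
      using subgroup.m_inv_closed[OF lower_central_subgroup] by (auto simp: nat_pow_inv simp del: lower_central.simps)
    fix y assume y: "y \<in> ?C"
    have "p (x \<otimes> y) [^]\<^bsub>Q\<^esub> m = p x [^]\<^bsub>Q\<^esub> m \<otimes>\<^bsub>Q\<^esub> p y [^]\<^bsub>Q\<^esub> m"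
      using p.H.pow_mult_distrib[OF central[of x y]] x y by simp
    then have "(x \<otimes> y) [^] m \<in> ?M" using x y pm[of x] pm[of y] pm[of "x \<otimes> y"] by simp
    then show "x \<otimes> y \<in> ?C"
      using x y subgroup.m_closed[OF lower_central_subgroup] by blast
  qed blast
  moreover have "g \<otimes> h \<otimes> inv g \<otimes> inv h \<in> ?C" if g: "g \<in> lower_central G i" and h: "h \<in> carrier G" for g h
  proof -
    have gG: "g \<in> carrier G" using g lower_central_carrier by blast
    define c where "c = g \<otimes> h \<otimes> inv g \<otimes> inv h"
    have c: "c \<in> carrier G" "c \<in> ?L"
      using gG h commutator_in_lower_central[OF g h] unfolding c_def by blast+
    have gh: "g \<otimes> h = c \<otimes> h \<otimes> g"
      using commutator_eq_iff[OF gG h c(1)] c_def by simp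
    have "p g \<otimes>\<^bsub>Q\<^esub> p h = p c \<otimes>\<^bsub>Q\<^esub> p h \<otimes>\<^bsub>Q\<^esub> p g"
      using arg_cong[OF gh, of p] gG h c by (simp only: p.hom_mult m_closed)
    then have "p g [^]\<^bsub>Q\<^esub> m \<otimes>\<^bsub>Q\<^esub> p h = p c [^]\<^bsub>Q\<^esub> m \<otimes>\<^bsub>Q\<^esub> p h \<otimes>\<^bsub>Q\<^esub> p g [^]\<^bsub>Q\<^esub> m"
      using p.H.pow_past_commutator[of "p g" "p h" "p c" m] central[OF c(2) gG] gG h c by simp
    moreover have "p g [^]\<^bsub>Q\<^esub> m \<otimes>\<^bsub>Q\<^esub> p h = p h \<otimes>\<^bsub>Q\<^esub> p g [^]\<^bsub>Q\<^esub> m"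
      using central[OF bspec[OF pow g] h] p.hom_nat_pow[OF gG] by simp
    ultimately have "p c [^]\<^bsub>Q\<^esub> m \<otimes>\<^bsub>Q\<^esub> (p h \<otimes>\<^bsub>Q\<^esub> p g [^]\<^bsub>Q\<^esub> m) = \<one>\<^bsub>Q\<^esub> \<otimes>\<^bsub>Q\<^esub> (p h \<otimes>\<^bsub>Q\<^esub> p g [^]\<^bsub>Q\<^esub> m)"
      using gG h c by (simp add: p.H.m_assoc)
    then have "p c [^]\<^bsub>Q\<^esub> m = \<one>\<^bsub>Q\<^esub>"
      using gG h c by (meson p.H.r_cancel p.H.nat_pow_closed p.H.m_closed p.H.one_closed p.hom_closed)
    then show ?thesis using pm c unfolding c_def by blast
  qed
  ultimately have "?L \<subseteq> ?C"
    by (subst lower_central.simps(2)) (rule generate_subgroup_incl, blast)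
  then show ?thesis by blast
qed

text \<open>If all elements were squares, the abelianization would have a finite exponent $k$; this exponent passes
to all quotients of successive terms of the lower central series, so $x^{k^c} = 1$ for all $x$, where
$c$ is the class. Without torsion this leaves only the trivial group.\<close>

lemma ex_nonsquare:
  assumes fg: "fin_gen_subgroup G (carrier G)" and nil: "nilpotent G" and tf: "torsion_free G"
    and nontriv: "carrier G \<noteq> {\<one>}"
  shows "\<exists>u\<in>carrier G. \<forall>s\<in>carrier G. s \<otimes> s \<noteq> u"
proof (rule ccontr)
  assume "\<not> ?thesis"
  then have sq: "\<exists>s\<in>carrier G. u = s \<otimes> s" if "u \<in> carrier G" for u using that by metis
  let ?D = "lower_central G (Suc 0)"
  define A where "A = G Mod ?D"
  define p where "p = (#>) ?D"
  interpret p: group_hom G A p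
    unfolding A_def p_def by (rule normal_is_kernel(1)[OF lower_central_normal])
  have comm: "comm_group A"
    unfolding A_def lower_central_1 by (rule derived_quot_is_comm_group)
  have one: "p x = \<one>\<^bsub>A\<^esub> \<longleftrightarrow> x \<in> ?D" if "x \<in> carrier G" for x
    unfolding A_def p_def by (rule normal_is_kernel(2)[OF lower_central_normal that])
  obtain S where S: "finite S" "S \<subseteq> carrier G" "carrier G = generate G S"
    using fg by (auto simp: fin_gen_subgroup_def)
  have gen: "generate A (p ` S) = p ` carrier G"
    using p.generate_img[OF S(2)] S(3) by simp
  have psq: "\<exists>y\<in>p ` carrier G. x = y \<otimes>\<^bsub>A\<^esub> y" if x: "x \<in> p ` carrier G" for x
  proof -
    obtain u where u: "u \<in> carrier G" "x = p u" using x by blast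
    obtain s where "s \<in> carrier G" "u = s \<otimes> s" using sq[OF u(1)] by blast
    then show ?thesis using u by auto
  qed
  have "\<exists>m::int. m \<noteq> 0 \<and> (\<forall>x\<in>generate A (p ` S). x [^]\<^bsub>A\<^esub> m = \<one>\<^bsub>A\<^esub>)"
    using S psq by (intro p.H.ex_finite_exponent_if_all_squares[OF comm]) (auto simp: gen)
  then obtain m :: int where m: "m \<noteq> 0" "\<forall>x\<in>p ` carrier G. x [^]\<^bsub>A\<^esub> m = \<one>\<^bsub>A\<^esub>"
    unfolding gen by blast
  define k where "k = nat \<bar>m\<bar>"
  have k: "k > 0" using m by (simp add: k_def)
  have base: "x [^] k \<in> lower_central G (Suc 0)" if x: "x \<in> carrier G" for x
  proof -
    have "x [^] m \<in> ?D"
      using m(2) x one[of "x [^] m"] p.hom_int_pow[OF x] by simp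
    then have "x [^] \<bar>m\<bar> \<in> ?D"
      using subgroup.m_inv_closed[OF lower_central_subgroup] x
      by (simp add: abs_if int_pow_neg del: lower_central.simps)
    then show ?thesis by (simp add: k_def pow_nat del: lower_central.simps)
  qed
  have step: "\<forall>x\<in>lower_central G i. x [^] k \<in> lower_central G (Suc i)" for i
  proof (induction i)
    case 0
    show ?case using base by simp
  qed (rule lower_central_pow_Suc)
  have tower: "x [^] (k ^ n) \<in> lower_central G n" if x: "x \<in> carrier G" for x n
  proof (induction n)
    case (Suc n)
    then have "(x [^] (k ^ n)) [^] k \<in> lower_central G (Suc n)" using step by blast
    then show ?case using x by (simp add: nat_pow_pow mult.commute del: lower_central.simps)
  qed (use x in simp)
  obtain c where c: "lower_central G c = {\<one>}" using nil by (auto simp: nilpotent_def)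
  have "x = \<one>" if x: "x \<in> carrier G" for x
    using tower[OF x, of c] c tf x k unfolding torsion_free_def by (metis singletonD zero_less_power)
  then show False using nontriv by blast
qed

end

section \<open>Isolators of cyclic subgroups\<close>

text \<open>The elements with a nontrivial power in the cyclic subgroup generated by \<open>h\<close>. In a torsion-free
nilpotent group this is the smallest subgroup that contains \<open>h\<close> and is closed under taking roots.\<close>

definition isolator :: "('g, 'm) monoid_scheme \<Rightarrow> 'g \<Rightarrow> 'g set" where
  "isolator G h = {s \<in> carrier G. \<exists>(n::int) (i::int). n \<noteq> 0 \<and> s [^]\<^bsub>G\<^esub> n = h [^]\<^bsub>G\<^esub> i}"

context group
begin

lemma isolator_commutes:
  assumes tf: "torsion_free G" and nil: "nilpotent G" and h: "h \<in> carrier G"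
    and t: "t \<in> carrier G" and ht: "h \<otimes> t = t \<otimes> h" and s: "s \<in> isolator G h"
  shows "s \<otimes> t = t \<otimes> s"
proof -
  obtain n i :: int where n: "n \<noteq> 0" "s [^] n = h [^] i" and sG: "s \<in> carrier G"
    using s by (auto simp: isolator_def)
  show ?thesis
    using commutes_if_int_pow_commutes[OF tf nil sG t n(1)] commutes_int_pow[OF h t ht, of i] n(2)
    by simp
qed

lemma isolator_subgroup:
  assumes tf: "torsion_free G" and nil: "nilpotent G" and h: "h \<in> carrier G"
  shows "subgroup (isolator G h) G"
proof (rule subgroupI)
  show "isolator G h \<subseteq> carrier G" by (auto simp: isolator_def)
  have "h \<in> isolator G h" using h by (auto simp: isolator_def intro!: exI[of _ 1])
  then show "isolator G h \<noteq> {}" by blast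
  fix s assume s: "s \<in> isolator G h"
  then obtain n i :: int where n: "n \<noteq> 0" "s [^] n = h [^] i" and sG: "s \<in> carrier G"
    by (auto simp: isolator_def)
  have "inv s [^] n = h [^] (- i)"
    using n sG h by (simp add: int_pow_inv int_pow_neg)
  then show "inv s \<in> isolator G h"
    unfolding isolator_def using n(1) sG by blast
  fix t assume t: "t \<in> isolator G h"
  then obtain m j :: int where m: "m \<noteq> 0" "t [^] m = h [^] j" and tG: "t \<in> carrier G"
    by (auto simp: isolator_def)
  have "s \<otimes> h = h \<otimes> s" by (rule isolator_commutes[OF tf nil h h refl s])
  then have "t \<otimes> s = s \<otimes> t"
    using isolator_commutes[OF tf nil h sG _ t] by simp
  then have "(s \<otimes> t) [^] (n * m) = (s [^] n) [^] m \<otimes> (t [^] m) [^] n"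
    using sG tG by (simp add: int_pow_mult_distrib int_pow_pow mult.commute)
  also have "\<dots> = h [^] (i * m + j * n)"
    unfolding n(2) m(2) using h by (simp add: int_pow_pow int_pow_mult)
  finally show "s \<otimes> t \<in> isolator G h"
    unfolding isolator_def using n(1) m(1) sG tG
    by (intro CollectI conjI exI[of _ "n * m"] exI[of _ "i * m + j * n"]) simp_all
qed

lemma isolator_square:
  assumes s: "s \<in> carrier G" and sq: "s \<otimes> s \<in> isolator G h"
  shows "s \<in> isolator G h"
proof -
  obtain n i :: int where n: "n \<noteq> 0" "(s \<otimes> s) [^] n = h [^] i"
    using sq by (auto simp: isolator_def)
  have "s [^] (n + n) = h [^] i"
    by (simp only: int_pow_mult[OF s] int_pow_mult_distrib[OF refl s s] n(2)[symmetric])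
  then show ?thesis
    unfolding isolator_def using s n(1)
    by (intro CollectI conjI exI[of _ "n + n"] exI[of _ i]) simp_all
qed

text \<open>The elements $u$ and $w$ generate a free abelian group of rank $2$. With $g = uw$ and $v = u w^2$ one has
$g^2 = uv$, so the even powers of $g$ factor through \<open>\<langle>u\<rangle>\<close> and \<open>\<langle>v\<rangle>\<close>. The criterion is applied
to the isolators of $u$ and $v$, which are closed under square roots. If $g = st$ with $s$ and $t$ in
these isolators, then comparing exponents of a common power shows that $s$ is a square root of $u$ up to
taking equal powers, hence exactly, as roots are unique; but $u$ is not a square.\<close>

lemma not_finite_approximability_if_commuting_nonsquare:
  assumes cnt: "countable (carrier G)" and tf: "torsion_free G" and nil: "nilpotent G"
    and u: "u \<in> carrier G" and w: "w \<in> carrier G" and uw: "u \<otimes> w = w \<otimes> u"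
    and nonsq: "\<And>s. s \<in> carrier G \<Longrightarrow> s \<otimes> s \<noteq> u"
    and indep: "\<And>(i::int) (j::int). u [^] i = w [^] j \<Longrightarrow> i = 0 \<and> j = 0"
  shows "\<not> finite_approximability_on_tournaments TYPE('x::infinite) G"
proof -
  define e where "e i j = u [^] i \<otimes> w [^] j" for i j :: int
  have eG: "e i j \<in> carrier G" for i j using u w by (simp add: e_def)
  have comm: "u [^] i \<otimes> w [^] j = w [^] j \<otimes> u [^] i" for i j :: int
    using commutes_int_pow[OF w _ commutes_int_pow[OF u w uw, symmetric], of i j] u by simp
  have e_mult: "e i j \<otimes> e k l = e (i + k) (j + l)" for i j k l
  proof -
    have "e i j \<otimes> e k l = u [^] i \<otimes> (w [^] j \<otimes> u [^] k) \<otimes> w [^] l"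
      using u w by (simp add: e_def m_assoc)
    also have "\<dots> = u [^] i \<otimes> (u [^] k \<otimes> w [^] j) \<otimes> w [^] l"
      unfolding comm ..
    also have "\<dots> = (u [^] i \<otimes> u [^] k) \<otimes> (w [^] j \<otimes> w [^] l)"
      using u w by (simp add: m_assoc)
    also have "\<dots> = e (i + k) (j + l)"
      using u w by (simp add: e_def int_pow_mult)
    finally show ?thesis .
  qed
  have e_pow: "e i j [^] n = e (i * n) (j * n)" for i j n :: int
    unfolding e_def using int_pow_mult_distrib[OF comm] u w by (simp add: int_pow_pow)
  \<comment> \<open>So \<open>e\<close> embeds the group of pairs of integers, and powers in it can be compared exponentwise.\<close>
  have e_inj: "i = k \<and> j = l" if eq: "e i j = e k l" for i j k l
  proof -
    have "e i j \<otimes> e (- k) (- j) = e k l \<otimes> e (- k) (- j)" using eq by simp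
    then have "e (i - k) 0 = e 0 (l - j)" by (simp add: e_mult)
    then have "u [^] (i - k) = w [^] (l - j)" using u w by (simp add: e_def)
    then show ?thesis using indep by fastforce
  qed
  define v where "v = e 1 2"
  have vG: "v \<in> carrier G" by (simp add: v_def eG)
  have ue: "u = e 1 0" using u by (simp add: e_def)
  have uv: "v \<otimes> u = u \<otimes> v" unfolding ue v_def e_mult by simp
  let ?H = "isolator G u" and ?K = "isolator G v"
  have uH: "u \<in> ?H" and vK: "v \<in> ?K"
    using u vG by (auto simp: isolator_def intro!: exI[of _ 1])
  show ?thesis
  proof (rule not_finite_approximabilityI[OF cnt isolator_subgroup[OF tf nil u]
        isolator_subgroup[OF tf nil vG] isolator_square isolator_square, of "{u}" "{v}" "e 1 1"])
    show "finite {u}" "finite {v}" "{u} \<subseteq> ?H" "{v} \<subseteq> ?K" "e 1 1 \<in> carrier G"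
      using uH vK eG by simp_all
    show "e 1 1 \<notin> ?H <#> ?K"
    proof
      assume "e 1 1 \<in> ?H <#> ?K"
      then obtain s t where s: "s \<in> ?H" and t: "t \<in> ?K" and st: "e 1 1 = s \<otimes> t"
        by (auto simp: set_mult_def)
      obtain n i :: int where n: "n \<noteq> 0" "s [^] n = u [^] i" and sG: "s \<in> carrier G"
        using s by (auto simp: isolator_def)
      obtain m j :: int where m: "m \<noteq> 0" "t [^] m = v [^] j" and tG: "t \<in> carrier G"
        using t by (auto simp: isolator_def)
      have "t \<otimes> u = u \<otimes> t" by (rule isolator_commutes[OF tf nil vG u uv t])
      then have comm: "s \<otimes> t = t \<otimes> s"
        using isolator_commutes[OF tf nil u tG _ s] by simp
      have "e (n * m) (n * m) = (s \<otimes> t) [^] (n * m)"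
        unfolding st[symmetric] e_pow by simp
      also have "\<dots> = (s [^] n) [^] m \<otimes> (t [^] m) [^] n"
        using int_pow_mult_distrib[OF comm sG tG] sG tG by (simp add: int_pow_pow mult.commute)
      also have "\<dots> = (e 1 0 [^] i) [^] m \<otimes> (e 1 2 [^] j) [^] n"
        unfolding n(2) m(2) v_def ue[symmetric] ..
      also have "\<dots> = e (i * m + j * n) (2 * j * n)"
        unfolding e_pow e_mult by simp
      \<comment> \<open>These equations give $im = jn$ and $n = 2i$, and $s^{2i} = u^i$ is then a relation between
        equal powers of $s^2$ and $u$.\<close>
      finally have "n * m = i * m + j * n" "n * m = 2 * j * n"
        using e_inj by blast+
      then have "n * m = i * m + j * n" "n * m = 2 * (j * n)"
        by (simp_all only: mult.assoc)
      then have "n * m = (i + i) * m"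
        by (simp only: distrib_right)
      then have ni: "n = i + i" using m(1) by simp
      then have "i \<noteq> 0" using n(1) by simp
      moreover have "(s \<otimes> s) [^] i = u [^] i"
        using n(2) unfolding ni by (simp only: int_pow_mult[OF sG] int_pow_mult_distrib[OF refl sG sG])
      ultimately have "s \<otimes> s = u"
        using int_roots_unique[OF tf nil _ u] sG by blast
      then show False using nonsq sG by blast
    qed
    fix k :: nat
    have "u [^] int k \<in> generate G {u}" "v [^] int k \<in> generate G {v}"
      using generate_pow[OF u] generate_pow[OF vG] by blast+
    moreover have "e 1 1 [^] (2 * k) = u [^] int k \<otimes> v [^] int k"
    proof -
      have "e 1 1 [^] (2 * k) = e 1 1 [^] int (2 * k)" by (rule int_pow_int[symmetric])
      also have "\<dots> = e 1 0 [^] int k \<otimes> e 1 2 [^] int k"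
        unfolding e_pow e_mult by simp
      finally show ?thesis unfolding ue[symmetric] v_def .
    qed
    ultimately show "e 1 1 [^] (2 * k) \<in> generate G {u} <#> generate G {v}"
      unfolding set_mult_def by blast
  qed
qed

section \<open>The infinite cyclic group\<close>

text \<open>With $p = p'd$ and $q = q'd$ for $d = \gcd(p, q)$, the relation $x^p = y^q$ gives $x^{p'} = y^{q'}$, because
there is no torsion. If \<open>r * p' + s * q' = 1\<close>, then $v = x^s y^r$ has $v^{q'} = x$ and $v^{p'} = y$.\<close>

lemma dependent_pair_in_cyclic:
  assumes tf: "torsion_free G" and x: "x \<in> carrier G" and y: "y \<in> carrier G" and xy: "x \<otimes> y = y \<otimes> x"
    and pq: "p \<noteq> 0 \<or> q \<noteq> 0" and eq: "x [^] (p::int) = y [^] (q::int)"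
  shows "\<exists>v\<in>carrier G. \<exists>(i::int) (j::int). x = v [^] i \<and> y = v [^] j"
proof -
  define d where "d = gcd p q"
  have d: "d \<noteq> 0" using pq by (simp add: d_def)
  obtain p' q' where p': "p = p' * d" and q': "q = q' * d"
    using gcd_dvd1[of p q] gcd_dvd2[of p q] unfolding d_def by (metis dvd_def mult.commute)
  obtain r s where "r * p + s * q = d" using bezout_int[of p q] unfolding d_def by blast
  then have "(r * p' + s * q') * d = 1 * d" by (simp add: p' q' algebra_simps)
  then have rs: "r * p' + s * q' = 1" using d mult_right_cancel by blast
  have comm: "x [^] i \<otimes> y [^] j = y [^] j \<otimes> x [^] i" for i j :: int
    using commutes_int_pow[OF y _ commutes_int_pow[OF x y xy, symmetric], of i j] x by simp
  have "(x [^] p' \<otimes> y [^] (- q')) [^] d = x [^] p \<otimes> inv (y [^] q)"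
    using int_pow_mult_distrib[OF comm[of p' "- q'"]] x y by (simp add: int_pow_pow p' q' int_pow_neg int_pow_inv)
  also have "\<dots> = \<one>" using eq y by simp
  finally have "x [^] p' \<otimes> y [^] (- q') = \<one>"
    using torsion_free_int_pow[OF tf _ _ d] x y by simp
  then have eq': "x [^] p' = y [^] q'"
    using x y by (metis int_pow_closed int_pow_neg inv_closed inv_equality inv_inv)
  define v where "v = x [^] s \<otimes> y [^] r"
  have vpow: "v [^] n = x [^] (s * n) \<otimes> y [^] (r * n)" for n
    unfolding v_def using int_pow_mult_distrib[OF comm[of s r], of n] x y by (simp add: int_pow_pow)
  have "y [^] (r * q') = x [^] (r * p')"
    using eq' x y by (metis int_pow_pow mult.commute)
  then have "v [^] q' = x [^] (s * q' + r * p')"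
    unfolding vpow using x by (simp add: int_pow_mult)
  then have vx: "v [^] q' = x" using rs x by (simp add: add.commute)
  have "x [^] (s * p') = y [^] (s * q')"
    using eq' x y by (metis int_pow_pow mult.commute)
  then have "v [^] p' = y [^] (s * q' + r * p')"
    unfolding vpow using y by (simp add: int_pow_mult)
  then have vy: "v [^] p' = y" using rs y by (simp add: add.commute)
  have "v \<in> carrier G" using x y by (simp add: v_def)
  then show ?thesis using vx vy by metis
qed

lemma finite_subset_in_cyclic_if_dependent:
  assumes tf: "torsion_free G"
    and comm: "\<And>x y. x \<in> carrier G \<Longrightarrow> y \<in> carrier G \<Longrightarrow> x \<otimes> y = y \<otimes> x"
    and dep: "\<And>x y. x \<in> carrier G \<Longrightarrow> y \<in> carrier G \<Longrightarrow> \<exists>(p::int) (q::int). (p \<noteq> 0 \<or> q \<noteq> 0) \<and> x [^] p = y [^] q"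
  shows "finite S \<Longrightarrow> S \<subseteq> carrier G \<Longrightarrow> \<exists>v\<in>carrier G. S \<subseteq> range (\<lambda>i::int. v [^] i)"
proof (induction S rule: finite_induct)
  case empty
  then show ?case by auto
next
  case (insert a S)
  then obtain v where v: "v \<in> carrier G" "S \<subseteq> range (\<lambda>i::int. v [^] i)" by blast
  have a: "a \<in> carrier G" using insert.prems by blast
  obtain p q :: int where "p \<noteq> 0 \<or> q \<noteq> 0" "v [^] p = a [^] q"
    using dep[OF v(1) a] by blast
  then obtain t and i j :: int where t: "t \<in> carrier G" "v = t [^] i" "a = t [^] j"
    using dependent_pair_in_cyclic[OF tf v(1) a comm[OF v(1) a]] by blast
  have "v [^] k \<in> range (\<lambda>i::int. t [^] i)" for k :: int
    unfolding t(2) using t(1) by (simp add: int_pow_pow)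
  then show ?case using v(2) t(1,3) by (intro bexI[of _ t]) blast+
qed

lemma iso_integer_group_if_dependent:
  assumes tf: "torsion_free G" and fg: "fin_gen_subgroup G (carrier G)" and nontriv: "carrier G \<noteq> {\<one>}"
    and comm: "\<And>x y. x \<in> carrier G \<Longrightarrow> y \<in> carrier G \<Longrightarrow> x \<otimes> y = y \<otimes> x"
    and dep: "\<And>x y. x \<in> carrier G \<Longrightarrow> y \<in> carrier G \<Longrightarrow> \<exists>(p::int) (q::int). (p \<noteq> 0 \<or> q \<noteq> 0) \<and> x [^] p = y [^] q"
  shows "G \<cong> integer_group"
proof -
  obtain S where S: "finite S" "S \<subseteq> carrier G" "carrier G = generate G S"
    using fg by (auto simp: fin_gen_subgroup_def)
  obtain v where v: "v \<in> carrier G" "S \<subseteq> range (\<lambda>i::int. v [^] i)"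
    using finite_subset_in_cyclic_if_dependent[OF tf comm dep S(1,2)] by blast
  have rng: "range (\<lambda>i::int. v [^] i) = generate G {v}"
    using generate_pow[OF v(1)] by auto
  have onto: "range (\<lambda>i::int. v [^] i) = carrier G"
  proof
    show "range (\<lambda>i::int. v [^] i) \<subseteq> carrier G" using v(1) by auto
    have "generate G S \<subseteq> generate G {v}"
      using generate_subgroup_incl[OF _ generate_is_subgroup, of S "{v}"] v rng by simp
    then show "carrier G \<subseteq> range (\<lambda>i::int. v [^] i)" using S(3) rng by simp
  qed
  have "v \<noteq> \<one>" using onto nontriv by auto
  have "inj (\<lambda>i::int. v [^] i)"
  proof (rule injI)
    fix i j :: int assume "v [^] i = v [^] j"
    then have "v [^] (i - j) = \<one>" using v(1) by (simp add: int_pow_diff)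
    then show "i = j" using torsion_free_int_pow[OF tf v(1)] \<open>v \<noteq> \<one>\<close> by force
  qed
  then have "(\<lambda>i::int. v [^] i) \<in> iso integer_group G"
    using hom_integer_group_pow[OF v(1)] onto by (simp add: iso_def bij_betw_def)
  then show ?thesis
    using group.iso_sym[OF group_integer_group] by (auto simp: is_iso_def)
qed

section \<open>Finitely generated torsion-free nilpotent groups\<close>

text \<open>Let $u$ be any element that is not a square. Suppose that everything commuting with $u$ is dependent on
$u$. Then $u$ has a power in common with a central element, hence is central itself as commuting with a
power implies commuting. So all elements are dependent on $u$, and they are central for the same reason:
the group is abelian of rank one and finitely generated, that is, infinite cyclic.\<close>

lemma ex_commuting_nonsquare:
  assumes fg: "fin_gen_subgroup G (carrier G)" and nil: "nilpotent G" and tf: "torsion_free G"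
    and nontriv: "carrier G \<noteq> {\<one>}" and not_Z: "\<not> G \<cong> integer_group"
  shows "\<exists>u\<in>carrier G. \<exists>w\<in>carrier G. u \<otimes> w = w \<otimes> u \<and> (\<forall>s\<in>carrier G. s \<otimes> s \<noteq> u) \<and>
    (\<forall>(i::int) (j::int). u [^] i = w [^] j \<longrightarrow> i = 0 \<and> j = 0)"
proof -
  obtain u where u: "u \<in> carrier G" and nonsq: "\<forall>s\<in>carrier G. s \<otimes> s \<noteq> u"
    using ex_nonsquare[OF fg nil tf nontriv] by blast
  have "\<exists>w\<in>carrier G. u \<otimes> w = w \<otimes> u \<and> (\<forall>(i::int) (j::int). u [^] i = w [^] j \<longrightarrow> i = 0 \<and> j = 0)"
  proof (rule ccontr)
    assume "\<not> ?thesis"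
    then have dep_u: "\<exists>(p::int) (q::int). (p \<noteq> 0 \<or> q \<noteq> 0) \<and> u [^] p = w [^] q"
      if "w \<in> carrier G" "u \<otimes> w = w \<otimes> u" for w using that by blast
    have u1: "u \<noteq> \<one>" using nonsq by force
    obtain z where z: "z \<in> carrier G" "z \<noteq> \<one>" "\<forall>x\<in>carrier G. z \<otimes> x = x \<otimes> z"
      using nilpotent_ex_central[OF nil nontriv] by blast
    obtain p q :: int where pq: "p \<noteq> 0 \<or> q \<noteq> 0" "u [^] p = z [^] q"
      using dep_u[OF z(1)] z(3) u by metis
    have "p \<noteq> 0"
      using pq torsion_free_int_pow[OF tf z(1), of q] z(2) by auto
    have ux: "u \<otimes> x = x \<otimes> u" if x: "x \<in> carrier G" for x
    proof (rule commutes_if_int_pow_commutes[OF tf nil u x \<open>p \<noteq> 0\<close>])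
      show "u [^] p \<otimes> x = x \<otimes> u [^] p"
        unfolding pq(2) using commutes_int_pow[OF z(1) x] z(3) x by blast
    qed
    have dep_u': "\<exists>(p::int) (q::int). q \<noteq> 0 \<and> u [^] p = x [^] q" if x: "x \<in> carrier G" for x
    proof -
      obtain p q :: int where pq: "p \<noteq> 0 \<or> q \<noteq> 0" "u [^] p = x [^] q"
        using dep_u[OF x ux[OF x]] by blast
      then have "q \<noteq> 0"
        using torsion_free_int_pow[OF tf u, of p] u1 by auto
      then show ?thesis using pq(2) by blast
    qed
    have comm: "x \<otimes> y = y \<otimes> x" if x: "x \<in> carrier G" and y: "y \<in> carrier G" for x y
    proof -
      obtain p q :: int where pq: "q \<noteq> 0" "u [^] p = x [^] q" using dep_u'[OF x] by blast
      show ?thesis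
        by (rule commutes_if_int_pow_commutes[OF tf nil x y pq(1)])
          (unfold pq(2)[symmetric], rule commutes_int_pow[OF u y ux[OF y]])
    qed
    have dep: "\<exists>(p::int) (q::int). (p \<noteq> 0 \<or> q \<noteq> 0) \<and> x [^] p = y [^] q"
      if x: "x \<in> carrier G" and y: "y \<in> carrier G" for x y
    proof -
      obtain p q :: int where pq: "q \<noteq> 0" "u [^] p = x [^] q" using dep_u'[OF x] by blast
      obtain r t :: int where rt: "t \<noteq> 0" "u [^] r = y [^] t" using dep_u'[OF y] by blast
      show ?thesis
      proof (cases "p = 0")
        case True
        then have "x = \<one>" using pq torsion_free_int_pow[OF tf x, of q] by simp
        then show ?thesis by (intro exI[of _ 1] exI[of _ 0]) simp
      next
        case False
        have "x [^] (q * r) = u [^] (p * r)" using pq(2) x u by (simp add: int_pow_pow[symmetric])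
        also have "\<dots> = u [^] (r * p)" by (simp add: mult.commute)
        also have "\<dots> = y [^] (t * p)" using rt(2) y u by (simp add: int_pow_pow[symmetric])
        finally show ?thesis using False rt(1) by (intro exI[of _ "q * r"] exI[of _ "t * p"]) simp
      qed
    qed
    show False
      using iso_integer_group_if_dependent[OF tf fg nontriv comm dep] not_Z by blast
  qed
  then show ?thesis using u nonsq by blast
qed

lemma countable_generate:
  assumes S: "S \<subseteq> carrier G" and cnt: "countable S"
  shows "countable (generate G S)"
proof -
  let ?A = "S \<union> (\<lambda>s. inv s) ` S"
  define word where "word xs = foldr (\<otimes>) xs \<one>" for xs
  have A: "?A \<subseteq> carrier G" using S by auto
  have closed: "word xs \<in> carrier G" if "set xs \<subseteq> ?A" for xs
    using that
  proof (induction xs)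
    case (Cons x xs)
    then have "x \<in> carrier G" using A by auto
    then show ?case using Cons by (simp add: word_def)
  qed (simp add: word_def)
  have append: "word (xs @ ys) = word xs \<otimes> word ys" if "set xs \<subseteq> ?A" "set ys \<subseteq> ?A" for xs ys
    using that
  proof (induction xs)
    case Nil
    then show ?case using closed[OF Nil(2)] by (simp add: word_def)
  next
    case (Cons x xs)
    have "x \<in> carrier G" "set xs \<subseteq> ?A" using Cons.prems A by auto
    then show ?case
      using Cons.IH Cons.prems closed[of xs] closed[of ys] by (simp add: word_def m_assoc)
  qed
  have "x \<in> word ` lists ?A" if "x \<in> generate G S" for x
    using that
  proof (induction rule: generate.induct)
    case one
    show ?case by (rule image_eqI[of _ _ "[]"]) (auto simp: word_def)
  next
    case (incl h)
    then show ?case using S by (intro image_eqI[of _ _ "[h]"]) (auto simp: word_def)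
  next
    case (inv h)
    then show ?case using S by (intro image_eqI[of _ _ "[inv h]"]) (auto simp: word_def)
  next
    case (eng h1 h2)
    then obtain xs ys where "xs \<in> lists ?A" "h1 = word xs" "ys \<in> lists ?A" "h2 = word ys" by blast
    then show ?case
      using append[of xs ys] by (intro image_eqI[of _ _ "xs @ ys"]) (auto simp: lists_eq_set)
  qed
  moreover have "countable (word ` lists ?A)" using cnt by auto
  ultimately show ?thesis by (meson countable_subset subsetI)
qed

end

theorem theorem1p6:
  fixes G :: "('g, 'm) monoid_scheme"
  assumes "group G"
  shows "(countable (carrier G) \<and>
          (\<exists>N. N \<lhd> G \<and> fin_gen_subgroup G N \<and>
               G Mod N \<cong> integer_group \<times>\<times> integer_group) \<longrightarrow>
          \<not> finite_approximability_on_tournaments TYPE('x::infinite) G) \<and>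
         (fin_gen_subgroup G (carrier G) \<and> nilpotent G \<and> torsion_free G \<and>
          carrier G \<noteq> {\<one>\<^bsub>G\<^esub>} \<and> \<not> G \<cong> integer_group \<longrightarrow>
          \<not> finite_approximability_on_tournaments TYPE('x) G)"
proof (intro conjI impI)
  interpret group G by fact
  show "\<not> finite_approximability_on_tournaments TYPE('x) G"
    if "countable (carrier G) \<and>
      (\<exists>N. N \<lhd> G \<and> fin_gen_subgroup G N \<and> G Mod N \<cong> integer_group \<times>\<times> integer_group)"
    using that not_finite_approximability_if_Mod_iso_Z2 by blast
  assume *: "fin_gen_subgroup G (carrier G) \<and> nilpotent G \<and> torsion_free G \<and>
    carrier G \<noteq> {\<one>\<^bsub>G\<^esub>} \<and> \<not> G \<cong> integer_group"
  obtain S where S: "finite S" "S \<subseteq> carrier G" "carrier G = generate G S"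
    using * by (auto simp: fin_gen_subgroup_def)
  have cnt: "countable (carrier G)"
    unfolding S(3) using countable_generate[OF S(2)] S(1) by (simp add: countable_finite)
  obtain u w where "u \<in> carrier G" "w \<in> carrier G" "u \<otimes>\<^bsub>G\<^esub> w = w \<otimes>\<^bsub>G\<^esub> u"
    and "\<forall>s\<in>carrier G. s \<otimes>\<^bsub>G\<^esub> s \<noteq> u"
    and "\<forall>(i::int) (j::int). u [^]\<^bsub>G\<^esub> i = w [^]\<^bsub>G\<^esub> j \<longrightarrow> i = 0 \<and> j = 0"
    using ex_commuting_nonsquare * by blast
  then show "\<not> finite_approximability_on_tournaments TYPE('x) G"
    using not_finite_approximability_if_commuting_nonsquare[OF cnt] * by blast
qed

end
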